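(* Let $f\colon\mathbb{R}^4\to\mathbb{R}^4$ be a reduced quasiconformal mapping (in the four-dimensional quaternionic sense). Then for any $q>1$ the mapping $f$ has finite $\phi$-variation on lines, where $$\phi(t)=\frac{t}{(\log(e+1/t))^q}\ \text{ if } t>0,\qquad \phi(0)=0.$$
   Context: Let $\mathbb{M}_4$ be the space of real $4\times4$ matrices, with the inner product $\operatorname{tr}(A^TB)$. For $\delta\in[-1,1]$ let $\mathbb{M}_4(\delta)=\{A\in\mathbb{M}_4\colon \langle Av,v\rangle\ge\delta|Av||v|\text{ for all }v\in\mathbb{R}^4\}$. A quaternion $\alpha+\beta\mathbf{i}+\gamma\mathbf{j}+\zeta\mathbf{k}$ is identified with the matrix $$Q=\begin{pmatrix}\alpha&-\beta&-\gamma&-\zeta\\ \beta&\alpha&-\zeta&\gamma\\ \gamma&\zeta&\alpha&-\beta\\ \zeta&-\gamma&\beta&\alpha\end{pmatrix},$$ so that the set of quaternions $\mathbb{H}$ is a 4-dimensional linear subspace of $\mathbb{M}_4$. Put $\operatorname{Re}Q=\alpha I$ and $\operatorname{Im}Q=Q-\operatorname{Re}Q$. For $A\in\mathbb{M}_4$ let $\mathbb{H}(A)$ be the orthogonal projection of $A$ onto $\mathbb{H}$. A homeomorphism $f\colon\mathbb{R}^4\to\mathbb{R}^4$ in $W^{1,4}_{\mathrm{loc}}(\mathbb{R}^4;\mathbb{R}^4)$ is called reduced quasiconformal if there exists $\delta>0$ such that for a.e. $x\in\mathbb{R}^4$ the derivative $A=Df(x)$ satisfies $A-\operatorname{Im}\mathbb{H}(A)\in\mathbb{M}_4(\delta)$.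 Let $\phi\colon[0,\infty)\to[0,\infty)$ be convex and strictly increasing with $\phi(0)=0$. For distinct points $a,b$ let $[a,b]$ be the closed line segment with endpoints $a,b$; a partition $0=t_0<t_1<\dots<t_N=1$ induces the partition $a_j=a+t_j(b-a)$, $j=0,\dots,N$, of $[a,b]$. A mapping $f$ on $[a,b]$ has finite $\phi$-variation on $[a,b]$ if $\sup\sum_{j=1}^N\phi(|f(a_j)-f(a_{j-1})|)<\infty$, the supremum being over all $N\ge1$ and all partitions $(a_j)_{j=0}^N$ of $[a,b]$. A mapping on a domain $\Omega$ has finite $\phi$-variation on lines if its restriction to every compact line segment contained in $\Omega$ has finite $\phi$-variation. *)

theory Defs
  imports "HOL-Analysis.Analysis"
begin

text \<open>Matrices are elements of \<^typ>\<open>real^4^4\<close>, with \<open>A $ i $ j\<close> the entry in row \<open>i\<close> and column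
  \<open>j\<close>. The library inner product on this type is the one given by the trace:\<close>

lemma inner_matrix_eq_trace: "A \<bullet> B = trace (transpose A ** B)" for A B :: "real^4^4"
  unfolding inner_vec_def trace_def transpose_def matrix_matrix_mult_def
  by simp (rule sum.swap)

definition matrix_cone :: "real \<Rightarrow> (real^4^4) set" where
  "matrix_cone \<delta> = {A. \<forall>v. (A *v v) \<bullet> v \<ge> \<delta> * norm (A *v v) * norm v}"

definition quat :: "real \<Rightarrow> real \<Rightarrow> real \<Rightarrow> real \<Rightarrow> real^4^4" where
  "quat \<alpha> \<beta> \<gamma> \<zeta> = vector
     [vector [\<alpha>, - \<beta>, - \<gamma>, - \<zeta>],
      vector [\<beta>,   \<alpha>, - \<zeta>,   \<gamma>],
      vector [\<gamma>,   \<zeta>,   \<alpha>, - \<beta>],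
      vector [\<zeta>, - \<gamma>,   \<beta>,   \<alpha>]]"

definition quaternions :: "(real^4^4) set" where
  "quaternions = {quat \<alpha> \<beta> \<gamma> \<zeta> | \<alpha> \<beta> \<gamma> \<zeta>. True}"

text \<open>Real and imaginary part are only meant for arguments in \<^const>\<open>quaternions\<close>.\<close>

definition quat_Re :: "real^4^4 \<Rightarrow> real^4^4" where
  "quat_Re Q = (Q $ 1 $ 1) *\<^sub>R mat 1"

definition quat_Im :: "real^4^4 \<Rightarrow> real^4^4" where
  "quat_Im Q = Q - quat_Re Q"

definition quat_proj :: "real^4^4 \<Rightarrow> real^4^4" where
  "quat_proj A = (THE Q. Q \<in> quaternions \<and> (\<forall>R\<in>quaternions. orthogonal (A - Q) R))"

lemma vector_4_nth [simp]:
  "(vector [a, b, c, d] :: 'a::zero^4) $ 1 = a"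
  "(vector [a, b, c, d] :: 'a::zero^4) $ 2 = b"
  "(vector [a, b, c, d] :: 'a::zero^4) $ 3 = c"
  "(vector [a, b, c, d] :: 'a::zero^4) $ 4 = d"
  unfolding vector_def by simp_all

lemma quat_Re_quat: "quat_Re (quat \<alpha> \<beta> \<gamma> \<zeta>) = \<alpha> *\<^sub>R mat 1"
  by (simp add: quat_Re_def quat_def)

lemma quat_eq_lincomb:
  "quat \<alpha> \<beta> \<gamma> \<zeta> = \<alpha> *\<^sub>R quat 1 0 0 0 + \<beta> *\<^sub>R quat 0 1 0 0 + \<gamma> *\<^sub>R quat 0 0 1 0 + \<zeta> *\<^sub>R quat 0 0 0 1"
  by (simp add: vec_eq_iff forall_4 quat_def)

lemma subspace_quaternions: "subspace quaternions"
proof (rule subspaceI)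
  show "0 \<in> quaternions"
    unfolding quaternions_def using quat_eq_lincomb[of 0 0 0 0] by force
next
  fix x y assume "x \<in> quaternions" "y \<in> quaternions"
  then obtain a b c d a' b' c' d' where "x = quat a b c d" "y = quat a' b' c' d'"
    unfolding quaternions_def by blast
  then have "x + y = quat (a + a') (b + b') (c + c') (d + d')"
    by (simp add: vec_eq_iff forall_4 quat_def)
  then show "x + y \<in> quaternions"
    unfolding quaternions_def by blast
next
  fix r x assume "x \<in> quaternions"
  then obtain a b c d where "x = quat a b c d"
    unfolding quaternions_def by blast
  then have "r *\<^sub>R x = quat (r * a) (r * b) (r * c) (r * d)"
    by (simp add: vec_eq_iff forall_4 quat_def)
  then show "r *\<^sub>R x \<in> quaternions"
    unfolding quaternions_def by blast
qed

lemma quat_proj_well_defined: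
  "\<exists>!Q. Q \<in> quaternions \<and> (\<forall>R\<in>quaternions. orthogonal (A - Q) R)"
proof (rule ex_ex1I)
  have span: "span quaternions = quaternions"
    using subspace_quaternions by (simp add: span_eq_iff)
  obtain y z where "y \<in> span quaternions" "\<And>w. w \<in> span quaternions \<Longrightarrow> orthogonal z w" "A = y + z"
    using orthogonal_subspace_decomp_exists by metis
  then show "\<exists>Q. Q \<in> quaternions \<and> (\<forall>R\<in>quaternions. orthogonal (A - Q) R)"
    by (auto simp: span intro!: exI[of _ y])
next
  fix P Q
  assume P: "P \<in> quaternions \<and> (\<forall>R\<in>quaternions. orthogonal (A - P) R)"
    and Q: "Q \<in> quaternions \<and> (\<forall>R\<in>quaternions. orthogonal (A - Q) R)"
  then have "P - Q \<in> quaternions"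
    using subspace_quaternions subspace_diff by blast
  with P Q have "(A - Q) \<bullet> (P - Q) = 0" "(A - P) \<bullet> (P - Q) = 0"
    by (auto simp: orthogonal_def)
  then have "(P - Q) \<bullet> (P - Q) = 0"
    by (simp add: inner_diff_left)
  then show "P = Q" by simp
qed

definition partial_deriv :: "4 \<Rightarrow> (real^4 \<Rightarrow> real) \<Rightarrow> real^4 \<Rightarrow> real" where
  "partial_deriv j u x = frechet_derivative u (at x) (axis j 1)"

text \<open>Infinite differentiability: all iterated partial derivatives are (totally) differentiable,
  hence in particular continuous.\<close>

definition smooth :: "(real^4 \<Rightarrow> real) \<Rightarrow> bool" where
  "smooth u \<longleftrightarrow> (\<forall>js x. foldr partial_deriv js u differentiable (at x))"

definition test_function :: "(real^4 \<Rightarrow> real) \<Rightarrow> bool" where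
  "test_function u \<longleftrightarrow> smooth u \<and> compact (closure {x. u x \<noteq> 0})"

definition Lp_loc :: "real \<Rightarrow> (real^4 \<Rightarrow> 'b::euclidean_space) \<Rightarrow> bool" where
  "Lp_loc p g \<longleftrightarrow> g \<in> borel_measurable lebesgue \<and>
     (\<forall>K. compact K \<longrightarrow> set_integrable lebesgue K (\<lambda>x. norm (g x) powr p))"

text \<open>Distributional derivative. It is unique up to Lebesgue null sets.\<close>

definition has_weak_derivative :: "(real^4 \<Rightarrow> real^4) \<Rightarrow> (real^4 \<Rightarrow> real^4^4) \<Rightarrow> bool" where
  "has_weak_derivative f Df \<longleftrightarrow> Lp_loc 1 f \<and> Lp_loc 1 Df \<and>
     (\<forall>u i j. test_function u \<longrightarrow>
        (\<integral>x. f x $ i * partial_deriv j u x \<partial>lebesgue) = - (\<integral>x. Df x $ i $ j * u x \<partial>lebesgue))"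

definition W1p_loc :: "real \<Rightarrow> (real^4 \<Rightarrow> real^4) \<Rightarrow> bool" where
  "W1p_loc p f \<longleftrightarrow> Lp_loc p f \<and> (\<exists>Df. has_weak_derivative f Df \<and> Lp_loc p Df)"

definition reduced_quasiconformal :: "(real^4 \<Rightarrow> real^4) \<Rightarrow> bool" where
  "reduced_quasiconformal f \<longleftrightarrow>
     (\<exists>g. homeomorphism UNIV UNIV f g) \<and> W1p_loc 4 f \<and>
     (\<exists>Df \<delta>. has_weak_derivative f Df \<and> 0 < \<delta> \<and> \<delta> \<le> 1 \<and>
        (AE x in lebesgue. Df x - quat_Im (quat_proj (Df x)) \<in> matrix_cone \<delta>))"

definition unit_partition :: "nat \<Rightarrow> (nat \<Rightarrow> real) \<Rightarrow> bool" where
  "unit_partition N t \<longleftrightarrow> N \<ge> 1 \<and> t 0 = 0 \<and> t N = 1 \<and> (\<forall>j<N. t j < t (Suc j))"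

definition finite_variation_on_segment ::
    "(real \<Rightarrow> real) \<Rightarrow> real^4 \<Rightarrow> real^4 \<Rightarrow> (real^4 \<Rightarrow> real^4) \<Rightarrow> bool" where
  "finite_variation_on_segment \<phi> a b f \<longleftrightarrow>
     bdd_above {\<Sum>j=1..N. \<phi> (norm (f (a + t j *\<^sub>R (b - a)) - f (a + t (j - 1) *\<^sub>R (b - a)))) | N t.
       unit_partition N t}"

definition finite_variation_on_lines ::
    "(real \<Rightarrow> real) \<Rightarrow> (real^4) set \<Rightarrow> (real^4 \<Rightarrow> real^4) \<Rightarrow> bool" where
  "finite_variation_on_lines \<phi> \<Omega> f \<longleftrightarrow>
     (\<forall>a b. a \<noteq> b \<and> closed_segment a b \<subseteq> \<Omega> \<longrightarrow> finite_variation_on_segment \<phi> a b f)"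

definition log_gauge :: "real \<Rightarrow> real \<Rightarrow> real" where
  "log_gauge q t = (if t > 0 then t / (ln (exp 1 + 1 / t)) powr q else 0)"

end

theory Submission
  imports Defs
begin

text \<open>The form \<open>T x y = (f x - f y) \<bullet> (x - y)\<close> is the basic quantity. The theorem follows from one inequality,
  the kink bound: for a point \<open>u = (1 - l) x + l y\<close> of a segment,
  \<open>norm (f u - (1 - l) f x - l f y) * norm (y - x) \<le> C * T y x\<close>.
  On a fixed line \<open>T y x / norm (y - x)\<close> is the increment of the component of \<open>f\<close> along the line, which is
  monotone. So inserting a point into a partition lengthens the inscribed polygon by at most
  a multiple of the increment of a monotone function, and by repeated halving any \<open>n\<close> increments of \<open>f\<close> on disjoint
  intervals have a sum of order \<open>1 + log n\<close>. Consequently the increments larger than \<open>exp (- L)\<close> have a sum of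
  order \<open>1 + L\<close>, whatever the partition. Grouping the increments by the levels \<open>exp (- 2\<^sup>i)\<close>, the
  gauge turns this into the convergent series \<open>\<Sum> 2\<^sup>i 2\<^sup>-\<^sup>i\<^sup>q\<close>; this uses \<open>q > 1\<close>
  (lemmas \<^emph>\<open>sum_increments_le_log_card\<close> and \<^emph>\<open>sum_log_gauge_le\<close>).

  The kink bound needs only a linear consequence of the hypothesis. Imaginary quaternions are
  skew, so they do not contribute to the quadratic form \<open>A v \<bullet> v\<close>, and membership of the rest in the cone
  forces \<open>A v \<bullet> v \<ge> c * trace A * (norm v)\<^sup>2 \<ge> 0\<close> with \<open>c = \<delta>\<^sup>2 / 96\<close>
  (lemma \<^emph>\<open>reduced_cone_quadratic_form_bounds\<close>). These inequalities are linear in \<open>A\<close> and therefore survive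
  convolution; since the kink bound involves three values of \<open>f\<close> and a constant that depends
  only on \<open>\<delta>\<close>, it suffices to prove it for smooth fields (lemma \<^emph>\<open>pinched_approximation\<close>).

  For a smooth field one may take the segment from \<open>- e\<close> to \<open>e\<close> with \<open>norm e = 1\<close>. Think of \<open>T x y\<close> as the
  work of a taut cable between \<open>x\<close> and \<open>y\<close>. Replace the cable between the ends by a bundle of cables
  that are bent at points \<open>z\<close> of a small ball of radius \<open>r\<close>, with a weight \<open>h z = max 0 (r\<^sup>2 - z \<bullet> z)\<close>. Bending costs
  lateral compression, whose total is \<open>2 \<integral> (h\<^sup>2 / 4) * div f\<close>. The bundle itself is under a tension of
  density at least a multiple of \<open>(c / r) * h\<^sup>2 * div f\<close>, which wins if \<open>r\<close> is small. Hence the weighted mean of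
  \<open>T z e + T z (- e)\<close> over the ball is at most \<open>T e (- e)\<close>. Monotonicity alone shows that the kink vector \<open>k\<close>
  satisfies \<open>k \<bullet> w \<le> T e (- e) + T w e + T w (- e)\<close> for all \<open>w\<close>, and averaging over \<open>w\<close> near the direction
  of \<open>k\<close> gives the bound (lemma \<^emph>\<open>pinched_kink_bound\<close>).\<close>

section \<open>Integration of compactly supported functions\<close>

lemma integrable_continuous_bounded_support:
  fixes F :: "'a::euclidean_space \<Rightarrow> real"
  assumes "continuous_on UNIV F" "bounded K" "\<And>x. x \<notin> K \<Longrightarrow> F x = 0"
  shows "integrable lborel F"
proof -
  obtain B where "\<forall>x\<in>K. norm x \<le> B"
    using \<open>bounded K\<close> unfolding bounded_iff by blast
  then have B: "K \<subseteq> cball 0 B" by auto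
  have "integrable lborel (\<lambda>x. indicator (cball 0 B) x *\<^sub>R F x)"
    using assms(1) by (intro borel_integrable_compact) (auto intro: continuous_on_subset)
  moreover have "(\<lambda>x. indicator (cball 0 B) x *\<^sub>R F x) = F"
    using B assms(3) by (force simp: indicator_def)
  ultimately show ?thesis by simp
qed

lemma integral_shift_lborel:
  fixes F :: "'a::euclidean_space \<Rightarrow> real"
  assumes "F \<in> borel_measurable borel"
  shows "(\<integral>x. F (x + a) \<partial>lborel) = (\<integral>x. F x \<partial>lborel)"
proof -
  have "(\<integral>x. F x \<partial>lborel) = (\<integral>x. F x \<partial>(distr lborel borel ((+) a)))"
    by (simp add: lborel_distr_plus)
  also have "\<dots> = (\<integral>x. F (a + x) \<partial>lborel)"
    using assms by (subst integral_distr) auto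
  finally show ?thesis by (simp add: add.commute)
qed

text \<open>The divergence theorem for fields of bounded support, in one direction at a time. The difference
  \<^term>\<open>G (x + v) - G x\<close> has integral \<open>0\<close> by translation invariance, and it is the integral of \<^term>\<open>g\<close> along
  a segment of direction \<^term>\<open>v\<close>; exchanging the two integrations leaves the integral of \<^term>\<open>g\<close>.\<close>
lemma integral_directional_derivative_bounded_support:
  fixes G g :: "'a::euclidean_space \<Rightarrow> real"
  assumes "bounded K" and supp: "\<And>x. x \<notin> K \<Longrightarrow> G x = 0" "\<And>x. x \<notin> K \<Longrightarrow> g x = 0"
    and cont: "continuous_on UNIV G" "continuous_on UNIV g"
    and deriv: "\<And>x t. ((\<lambda>t. G (x + t *\<^sub>R v)) has_real_derivative g (x + t *\<^sub>R v)) (at t)"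
  shows "(\<integral>x. g x \<partial>lborel) = 0"
proof -
  obtain B where B: "\<And>x. x \<in> K \<Longrightarrow> norm x \<le> B"
    using \<open>bounded K\<close> unfolding bounded_iff by blast
  \<comment> \<open>Large enough to contain every \<open>x\<close> for which the segment from \<open>x\<close> to \<open>x + v\<close> meets the support.\<close>
  define C where "C = cball (0::'a) (B + norm v)"
  have intG: "integrable lborel G" and intg: "integrable lborel g"
    using integrable_continuous_bounded_support \<open>bounded K\<close> cont supp by blast+
  have [measurable]: "G \<in> borel_measurable borel" "g \<in> borel_measurable borel"
    using cont borel_measurable_continuous_onI by blast+
  have ftc: "(\<integral>t. indicator {0..1} t *\<^sub>R g (x + t *\<^sub>R v) \<partial>lborel) = G (x + v) - G x" for x
  proof -
    have "(\<integral>t. indicator {0..1} t *\<^sub>R g (x + t *\<^sub>R v) \<partial>lborel) = G (x + 1 *\<^sub>R v) - G (x + 0 *\<^sub>R v)"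
      apply (rule integral_FTC_atLeastAtMost)
      subgoal by simp
      subgoal for t using deriv[of x t]
        by (metis has_real_derivative_iff_has_vector_derivative has_vector_derivative_at_within)
      subgoal by (intro continuous_on_compose2[OF cont(2)] continuous_intros) auto
      done
    then show ?thesis by simp
  qed
  define \<Phi> where "\<Phi> = (\<lambda>x t. indicator {0..1::real} t *\<^sub>R g (x + t *\<^sub>R v))"
  have intP: "integrable (lborel \<Otimes>\<^sub>M lborel) (\<lambda>(x, t). \<Phi> x t)"
  proof -
    have "integrable lborel (\<lambda>p. indicator (C \<times> {0..1::real}) p *\<^sub>R (\<lambda>(x, t). g (x + t *\<^sub>R v)) p)"
      by (intro borel_integrable_compact)
        (auto intro!: compact_Times continuous_on_compose2[OF cont(2)] continuous_intros
            simp: C_def split_beta)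
    moreover have "indicator (C \<times> {0..1::real}) p *\<^sub>R (\<lambda>(x, t). g (x + t *\<^sub>R v)) p = (\<lambda>(x, t). \<Phi> x t) p" for p
    proof (cases p)
      case (Pair x t)
      have "g (x + t *\<^sub>R v) = 0" if "x \<notin> C" "0 \<le> t" "t \<le> 1"
      proof (rule supp(2), rule notI)
        assume "x + t *\<^sub>R v \<in> K"
        from B[OF this] have "norm (x + t *\<^sub>R v) \<le> B" .
        moreover have "norm x \<le> norm (x + t *\<^sub>R v) + norm (t *\<^sub>R v)"
          by (metis add_diff_cancel_right' norm_triangle_ineq4)
        moreover have "norm (t *\<^sub>R v) \<le> norm v"
          using that by (simp add: mult_left_le_one_le)
        ultimately show False using \<open>x \<notin> C\<close> by (simp add: C_def)
      qed
      then show ?thesis by (auto simp: Pair \<Phi>_def indicator_def)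
    qed
    ultimately show ?thesis by (simp add: lborel_prod)
  qed
  have "integrable lborel (\<lambda>x. G (x + v))"
    by (rule integrable_continuous_bounded_support[where K = "(\<lambda>x. x - v) ` K"])
      (auto intro!: continuous_on_compose2[OF cont(1)] continuous_intros bounded_translation_minus
        \<open>bounded K\<close> supp simp: image_iff algebra_simps)
  then have "0 = (\<integral>x. G (x + v) - G x \<partial>lborel)"
    using integral_shift_lborel[of G v] intG by simp
  also have "\<dots> = (\<integral>x. (\<integral>t. \<Phi> x t \<partial>lborel) \<partial>lborel)"
    unfolding \<Phi>_def ftc by simp
  also have "\<dots> = (\<integral>t. (\<integral>x. \<Phi> x t \<partial>lborel) \<partial>lborel)"
    using lborel_pair.Fubini_integral[OF intP] by simp
  also have "\<dots> = (\<integral>t. indicator {0..1::real} t *\<^sub>R (\<integral>x. g x \<partial>lborel) \<partial>lborel)"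
    unfolding \<Phi>_def using integral_shift_lborel[of g] by simp
  also have "\<dots> = (\<integral>x. g x \<partial>lborel)"
    by simp
  finally show ?thesis by simp
qed

lemma nn_integral_affine_expansion_le:
  fixes \<phi> :: "'a::euclidean_space \<Rightarrow> ennreal"
  assumes [measurable]: "\<phi> \<in> borel_measurable borel" and k: "1 \<le> k"
  shows "(\<integral>\<^sup>+y. \<phi> (a + k *\<^sub>R y) \<partial>lborel) \<le> (\<integral>\<^sup>+z. \<phi> z \<partial>lborel)"
proof -
  have "(\<integral>\<^sup>+z. \<phi> z \<partial>lborel)
      = (\<integral>\<^sup>+z. \<phi> z \<partial>density (distr lborel borel (\<lambda>y. a + k *\<^sub>R y)) (\<lambda>_. ennreal (\<bar>k\<bar> ^ DIM('a))))"
    using lborel_affine[of k a] k by simp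
  also have "\<dots> = (\<integral>\<^sup>+y. ennreal (\<bar>k\<bar> ^ DIM('a)) * \<phi> (a + k *\<^sub>R y) \<partial>lborel)"
    by (simp add: nn_integral_density nn_integral_distr)
  also have "\<dots> \<ge> (\<integral>\<^sup>+y. 1 * \<phi> (a + k *\<^sub>R y) \<partial>lborel)"
    using k by (intro nn_integral_mono mult_right_mono) (auto simp: one_le_power)
  finally show ?thesis by simp
qed

section \<open>Fields with pinched symmetric gradient\<close>

text \<open>The field \<^term>\<open>f\<close> is a monotone operator when this form is nonnegative. It is useful to read
  \<open>mono_form f x y\<close> as the work done by a taut cable that joins \<open>x\<close> and \<open>y\<close> when the space is displaced
  by \<open>f\<close>: equilibrium of a system of cables then becomes an identity between values of the form.\<close>
definition mono_form :: "('a::real_inner \<Rightarrow> 'a) \<Rightarrow> 'a \<Rightarrow> 'a \<Rightarrow> real" where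
  "mono_form f x y = (f x - f y) \<bullet> (x - y)"

definition trace_of :: "('a::euclidean_space \<Rightarrow> 'a) \<Rightarrow> real" where
  "trace_of L = (\<Sum>b\<in>Basis. L b \<bullet> b)"

text \<open>Only derivatives along lines are asked for, since all estimates integrate along lines. The last
  two conditions say that the symmetric part of the derivative is positive semidefinite and that its
  smallest eigenvalue is at least \<open>c\<close> times its trace. Both
  conditions are linear in the derivative, which is why convolution preserves them.\<close>
definition pinched :: "real \<Rightarrow> ('a::euclidean_space \<Rightarrow> 'a) \<Rightarrow> ('a \<Rightarrow> 'a \<Rightarrow> 'a) \<Rightarrow> bool" where
  "pinched c f A \<longleftrightarrow>
     (\<forall>x v t. ((\<lambda>t. f (x + t *\<^sub>R v)) has_vector_derivative A (x + t *\<^sub>R v) v) (at t)) \<and>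
     continuous_on UNIV f \<and> (\<forall>v. continuous_on UNIV (\<lambda>x. A x v)) \<and> (\<forall>x. linear (A x)) \<and>
     (\<forall>x v. 0 \<le> A x v \<bullet> v) \<and> (\<forall>x v. c * trace_of (A x) * (norm v)\<^sup>2 \<le> A x v \<bullet> v)"

lemma mono_form_commute: "mono_form f x y = mono_form f y x"
  unfolding mono_form_def by (simp add: inner_diff algebra_simps)

lemma
  assumes "pinched c f A"
  shows pinched_continuous_trace: "continuous_on UNIV (\<lambda>x. trace_of (A x))"
    and pinched_trace_nonneg: "0 \<le> trace_of (A x)"
    and pinched_deriv: "((\<lambda>t. f (x + t *\<^sub>R v)) has_vector_derivative A (x + t *\<^sub>R v) v) (at t)"
    and pinched_lower: "c * trace_of (A x) * (norm v)\<^sup>2 \<le> A x v \<bullet> v"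
    and pinched_nonneg: "0 \<le> A x v \<bullet> v"
    and pinched_continuous: "continuous_on UNIV f"
    and pinched_continuous_deriv: "continuous_on UNIV (\<lambda>x. A x v)"
    and pinched_linear: "linear (A x)"
proof -
  note P = assms[unfolded pinched_def]
  show "continuous_on UNIV (\<lambda>x. trace_of (A x))"
    unfolding trace_of_def using P by (intro continuous_on_sum continuous_on_inner continuous_on_const) simp
  show "0 \<le> trace_of (A x)"
    unfolding trace_of_def using P by (intro sum_nonneg) simp
  show "((\<lambda>t. f (x + t *\<^sub>R v)) has_vector_derivative A (x + t *\<^sub>R v) v) (at t)"
    "c * trace_of (A x) * (norm v)\<^sup>2 \<le> A x v \<bullet> v" "0 \<le> A x v \<bullet> v"
    "continuous_on UNIV f" "continuous_on UNIV (\<lambda>x. A x v)" "linear (A x)"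
    using P by simp_all
qed

lemma pinched_deriv_along_segment:
  assumes "pinched c f A"
  shows "((\<lambda>t. f (x - t *\<^sub>R v) \<bullet> v) has_real_derivative - (A (x - t *\<^sub>R v) v \<bullet> v)) (at t)"
proof -
  have lin: "linear (A y)" for y using pinched_linear[OF assms] .
  have "((\<lambda>t. f (x + t *\<^sub>R (- v)) \<bullet> v) has_vector_derivative A (x + t *\<^sub>R (- v)) (- v) \<bullet> v) (at t)"
    using bounded_linear.has_vector_derivative[OF bounded_linear_inner_left pinched_deriv[OF assms]] .
  then show ?thesis
    by (simp add: has_real_derivative_iff_has_vector_derivative linear_neg[OF lin])
qed

lemma pinched_antimono_along_segment:
  assumes "pinched c f A" "s \<le> t"
  shows "f (x - t *\<^sub>R v) \<bullet> v \<le> f (x - s *\<^sub>R v) \<bullet> v"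
proof (rule DERIV_nonpos_imp_nonincreasing[OF assms(2), of "\<lambda>t. f (x - t *\<^sub>R v) \<bullet> v"])
  fix t
  show "\<exists>y. ((\<lambda>t. f (x - t *\<^sub>R v) \<bullet> v) has_real_derivative y) (at t) \<and> y \<le> 0"
    using pinched_deriv_along_segment[OF assms(1), of x v t] pinched_nonneg[OF assms(1), of "x - t *\<^sub>R v" v]
    by (intro exI[of _ "- (A (x - t *\<^sub>R v) v \<bullet> v)"]) simp
qed

lemma pinched_mono_form_nonneg:
  assumes "pinched c f A"
  shows "0 \<le> mono_form f x y"
  using pinched_antimono_along_segment[OF assms, of 0 1 x "x - y"]
  by (simp add: mono_form_def inner_diff_left)

text \<open>Only the half of the segment adjacent to \<^term>\<open>x\<close> is kept. In the application \<^term>\<open>y\<close> is the common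
  end of a bundle of segments, whose density is unbounded near \<^term>\<open>y\<close>.\<close>
lemma pinched_mono_form_ge_trace_integral:
  assumes P: "pinched c f A" and "c \<ge> 0"
  shows "(\<integral>\<^sup>+t. ennreal (c * (norm (x - y))\<^sup>2 * trace_of (A (x - t *\<^sub>R (x - y)))) * indicator {0..1/2} t \<partial>lborel)
    \<le> ennreal (mono_form f x y)"
proof -
  define v where "v = x - y"
  define \<phi> where "\<phi> t = f (x - t *\<^sub>R v) \<bullet> v" for t
  define w where "w t = c * (norm v)\<^sup>2 * trace_of (A (x - t *\<^sub>R v))" for t
  have w0: "0 \<le> w t" for t
    unfolding w_def using pinched_trace_nonneg[OF P] \<open>c \<ge> 0\<close> by simp
  have "continuous_on UNIV w"
    unfolding w_def
    by (intro continuous_intros continuous_on_compose2[OF pinched_continuous_trace[OF P]]) auto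
  then have cw: "continuous_on {0..1/2} w" using continuous_on_subset by blast
  have ib: "integral {0..1/2} w \<le> \<phi> 0 - \<phi> (1/2)"
  proof (rule has_integral_le)
    show "(w has_integral integral {0..1/2} w) {0..1/2}"
      using cw integrable_continuous_interval integrable_integral by blast
    have "((\<lambda>t. - (A (x - t *\<^sub>R v) v \<bullet> v)) has_integral \<phi> (1/2) - \<phi> 0) {0..1/2}"
      unfolding \<phi>_def
      by (rule fundamental_theorem_of_calculus, simp, rule has_vector_derivative_at_within,
          rule pinched_deriv_along_segment[OF P, unfolded has_real_derivative_iff_has_vector_derivative])
    from has_integral_neg[OF this]
    show "((\<lambda>t. A (x - t *\<^sub>R v) v \<bullet> v) has_integral \<phi> 0 - \<phi> (1/2)) {0..1/2}" by simp
    show "w t \<le> A (x - t *\<^sub>R v) v \<bullet> v" for t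
      using pinched_lower[OF P, of "x - t *\<^sub>R v" v] by (simp add: w_def mult_ac)
  qed
  also have "\<dots> \<le> \<phi> 0 - \<phi> 1"
    using pinched_antimono_along_segment[OF P, of "1/2" 1 x v] by (simp add: \<phi>_def)
  also have "\<phi> 0 - \<phi> 1 = mono_form f x y"
    by (simp add: \<phi>_def mono_form_def v_def inner_diff_left)
  finally have "integral {0..1/2} w \<le> mono_form f x y" .
  moreover have "(\<integral>\<^sup>+t. ennreal (w t) * indicator {0..1/2} t \<partial>lborel) = ennreal (integral {0..1/2} w)"
    using nn_integral_has_integral_lebesgue'[of "{0..1/2}" w] w0
      integrable_integral[OF integrable_continuous_interval[OF cw]] by simp
  ultimately show ?thesis
    by (simp add: w_def v_def ennreal_leI)
qed

section \<open>A radial weight and the balance of forces\<close>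

text \<open>This weight is chosen because \<open>z \<mapsto> - cap r z *\<^sub>R z\<close> is the gradient of the function
  \<open>(cap r z)\<^sup>2 / 4\<close>, which is continuously differentiable, has bounded support, and is at most
  \<open>r\<^sup>2 / 4\<close> times the weight itself.\<close>
definition cap :: "real \<Rightarrow> 'a::real_inner \<Rightarrow> real" where
  "cap r z = max 0 (r\<^sup>2 - z \<bullet> z)"

lemma cap_nonneg: "0 \<le> cap r z" by (simp add: cap_def)

lemma cap_le: "cap r z \<le> r\<^sup>2" by (simp add: cap_def)

lemma cap_eq_0: "r \<ge> 0 \<Longrightarrow> z \<notin> cball 0 r \<Longrightarrow> cap r z = 0"
  by (auto simp: cap_def dot_square_norm max_def power_mono not_le)

lemma continuous_on_cap: "continuous_on S (cap r)"
  unfolding cap_def by (intro continuous_intros)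

lemma DERIV_max_zero_square: "((\<lambda>s. (max 0 s)\<^sup>2) has_real_derivative 2 * max 0 s) (at (s::real))"
proof -
  consider "s < 0" | "s = 0" | "s > 0" by linarith
  then show ?thesis
  proof cases
    case 1
    have "((\<lambda>s. 0) has_real_derivative 2 * max 0 s) (at s)" using 1 by simp
    then show ?thesis
      by (rule has_field_derivative_transform_within_open[of _ _ _ "{..<0}"]) (use 1 in auto)
  next
    case 2
    have "((\<lambda>h. (max 0 h)\<^sup>2 / h) \<longlongrightarrow> 0) (at (0::real))"
    proof (rule Lim_null_comparison[where g = "\<lambda>h. \<bar>h\<bar>"])
      show "\<forall>\<^sub>F h in at (0::real). norm ((max 0 h)\<^sup>2 / h) \<le> \<bar>h\<bar>"
        by (intro always_eventually allI) (auto simp: max_def power2_eq_square)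
      show "((\<lambda>h::real. \<bar>h\<bar>) \<longlongrightarrow> 0) (at 0)"
        by (rule tendsto_rabs_zero) simp
    qed
    then show ?thesis using 2 by (simp add: DERIV_def)
  next
    case 3
    have "((\<lambda>s. s\<^sup>2) has_real_derivative 2 * max 0 s) (at s)" using 3
      by (auto intro!: derivative_eq_intros)
    then show ?thesis
      by (rule has_field_derivative_transform_within_open[of _ _ _ "{0<..}"]) (use 3 in auto)
  qed
qed

lemma cap_square_deriv_along_line:
  "((\<lambda>t. (cap r (x + t *\<^sub>R v))\<^sup>2 / 4) has_real_derivative - (cap r (x + t *\<^sub>R v) * ((x + t *\<^sub>R v) \<bullet> v))) (at t)"
proof -
  define q where "q t = r\<^sup>2 - (x + t *\<^sub>R v) \<bullet> (x + t *\<^sub>R v)" for t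
  have "q t = r\<^sup>2 - x \<bullet> x - 2 * t * (x \<bullet> v) - t\<^sup>2 * (v \<bullet> v)" for t
    by (simp add: q_def inner_add inner_commute power2_eq_square algebra_simps)
  then have "q = (\<lambda>t. r\<^sup>2 - x \<bullet> x - 2 * t * (x \<bullet> v) - t\<^sup>2 * (v \<bullet> v))" by (intro ext)
  then have "(q has_real_derivative - 2 * ((x + t *\<^sub>R v) \<bullet> v)) (at t)"
    by (auto intro!: derivative_eq_intros simp: inner_add_left algebra_simps)
  from DERIV_chain2[OF DERIV_max_zero_square this]
  have "((\<lambda>t. (max 0 (q t))\<^sup>2 / 4) has_real_derivative (2 * max 0 (q t) * (- 2 * ((x + t *\<^sub>R v) \<bullet> v))) / 4) (at t)"
    by (rule DERIV_cdivide)
  then show ?thesis by (simp add: cap_def q_def)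
qed

text \<open>Integration by parts, with \<open>(cap r z)\<^sup>2 / 4\<close> as the potential of the radial weight.\<close>
lemma integral_cap_radial:
  fixes f :: "'a::euclidean_space \<Rightarrow> 'a"
  assumes P: "pinched c f A" and r: "0 \<le> r"
  shows "(\<integral>z. cap r z * (f z \<bullet> z) \<partial>lborel) = (\<integral>z. (cap r z)\<^sup>2 / 4 * trace_of (A z) \<partial>lborel)"
proof -
  note cont = continuous_on_cap pinched_continuous[OF P] pinched_continuous_deriv[OF P] continuous_intros
  have int: "integrable lborel F" if "continuous_on UNIV F" "\<And>z. cap r z = 0 \<Longrightarrow> F z = 0" for F :: "'a \<Rightarrow> real"
    using integrable_continuous_bounded_support[OF that(1), of "cball 0 r"] that(2) cap_eq_0[OF r] by blast
  have cz: "\<not> norm z \<le> r \<Longrightarrow> cap r z = 0" for z :: 'a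
    using cap_eq_0[OF r] by simp
  have eq: "(\<integral>z. cap r z * (z \<bullet> b) * (f z \<bullet> b) \<partial>lborel) = (\<integral>z. (cap r z)\<^sup>2 / 4 * (A z b \<bullet> b) \<partial>lborel)" for b
  proof -
    have "(\<integral>z. (cap r z)\<^sup>2 / 4 * (A z b \<bullet> b) - cap r z * (z \<bullet> b) * (f z \<bullet> b) \<partial>lborel) = 0"
    proof (rule integral_directional_derivative_bounded_support[where K = "cball 0 r" and v = b
          and G = "\<lambda>z. (cap r z)\<^sup>2 / 4 * (f z \<bullet> b)"])
      fix x t
      have "((\<lambda>t. f (x + t *\<^sub>R b) \<bullet> b) has_real_derivative A (x + t *\<^sub>R b) b \<bullet> b) (at t)"
        using bounded_linear.has_vector_derivative[OF bounded_linear_inner_left pinched_deriv[OF P]]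
        by (simp add: has_real_derivative_iff_has_vector_derivative)
      from DERIV_mult[OF cap_square_deriv_along_line this]
      show "((\<lambda>t. (cap r (x + t *\<^sub>R b))\<^sup>2 / 4 * (f (x + t *\<^sub>R b) \<bullet> b)) has_real_derivative
          (cap r (x + t *\<^sub>R b))\<^sup>2 / 4 * (A (x + t *\<^sub>R b) b \<bullet> b)
          - cap r (x + t *\<^sub>R b) * ((x + t *\<^sub>R b) \<bullet> b) * (f (x + t *\<^sub>R b) \<bullet> b)) (at t)"
        by (rule DERIV_cong) (simp add: algebra_simps)
    qed (auto intro!: cont simp: cz)
    moreover have "integrable lborel (\<lambda>z. (cap r z)\<^sup>2 / 4 * (A z b \<bullet> b))"
      "integrable lborel (\<lambda>z. cap r z * (z \<bullet> b) * (f z \<bullet> b))"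
      by (auto intro!: int cont)
    ultimately show ?thesis by simp
  qed
  have "(\<integral>z. cap r z * (f z \<bullet> z) \<partial>lborel) = (\<integral>z. (\<Sum>b\<in>Basis. cap r z * (z \<bullet> b) * (f z \<bullet> b)) \<partial>lborel)"
    by (subst euclidean_inner) (simp add: sum_distrib_left mult_ac)
  also have "\<dots> = (\<Sum>b\<in>Basis. \<integral>z. cap r z * (z \<bullet> b) * (f z \<bullet> b) \<partial>lborel)"
    by (rule Bochner_Integration.integral_sum) (auto intro!: int cont)
  also have "\<dots> = (\<Sum>b\<in>Basis. \<integral>z. (cap r z)\<^sup>2 / 4 * (A z b \<bullet> b) \<partial>lborel)"
    by (simp only: eq)
  also have "\<dots> = (\<integral>z. (\<Sum>b\<in>Basis. (cap r z)\<^sup>2 / 4 * (A z b \<bullet> b)) \<partial>lborel)"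
    by (rule Bochner_Integration.integral_sum[symmetric]) (auto intro!: int cont)
  finally show ?thesis by (simp add: trace_of_def sum_distrib_left)
qed

text \<open>The case of a constant field, whose derivative vanishes.\<close>
lemma integral_cap_inner: "0 \<le> r \<Longrightarrow> (\<integral>z. cap r z * (a \<bullet> z) \<partial>lborel) = 0" for a :: "'a::euclidean_space"
proof -
  assume "0 \<le> r"
  have "pinched 0 (\<lambda>_. a) (\<lambda>_ _. 0)"
    unfolding pinched_def by (auto simp: linear_zero)
  from integral_cap_radial[OF this \<open>0 \<le> r\<close>] show ?thesis by (simp add: trace_of_def)
qed

text \<open>For a single \<^term>\<open>z\<close> the two cables from \<^term>\<open>z\<close> to the ends \<open>\<plusminus>e\<close> do half the work of the cable between the
  ends, plus \<open>2 (f z \<bullet> z)\<close>, minus a term linear in \<^term>\<open>z\<close>. The weighted mean removes the linear term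
  and turns the middle one into an integral of the divergence. That integral is the price of bending
  a straight cable into a bundle, and it has to be beaten by the tension in the bundle.\<close>
lemma integral_cap_mono_form:
  fixes f :: "'a::euclidean_space \<Rightarrow> 'a"
  assumes P: "pinched c f A" and r: "0 \<le> r"
  shows "(\<integral>z. cap r z * (mono_form f z e + mono_form f z (- e)) \<partial>lborel)
    = mono_form f e (- e) / 2 * (\<integral>z. cap r (z::'a) \<partial>lborel)
      + 2 * (\<integral>z. (cap r z)\<^sup>2 / 4 * trace_of (A z) \<partial>lborel)"
proof -
  note cont = continuous_on_cap pinched_continuous[OF P] continuous_intros
  have int: "integrable lborel F" if "continuous_on UNIV F" "\<And>z. cap r z = 0 \<Longrightarrow> F z = 0" for F :: "'a \<Rightarrow> real"
    using integrable_continuous_bounded_support[OF that(1), of "cball 0 r"] that(2) cap_eq_0[OF r] by blast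
  have i1: "integrable lborel (\<lambda>z::'a. cap r z)"
    by (rule int) (auto intro: continuous_on_cap)
  have i2: "integrable lborel (\<lambda>z. cap r z * (f z \<bullet> z))"
    by (rule int) (auto intro!: cont)
  have i3: "integrable lborel (\<lambda>z. cap r z * ((f e + f (- e)) \<bullet> z))"
    by (rule int) (auto intro!: continuous_on_cap continuous_intros)
  have "cap r z * (mono_form f z e + mono_form f z (- e))
      = mono_form f e (- e) / 2 * cap r z + 2 * (cap r z * (f z \<bullet> z)) - cap r z * ((f e + f (- e)) \<bullet> z)" for z
  proof -
    have "mono_form f z e + mono_form f z (- e) = mono_form f e (- e) / 2 + 2 * (f z \<bullet> z) - (f e + f (- e)) \<bullet> z"
      by (simp add: mono_form_def inner_diff inner_add field_simps)
    then show ?thesis by (simp only:) (simp add: algebra_simps)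
  qed
  then have "(\<integral>z. cap r z * (mono_form f z e + mono_form f z (- e)) \<partial>lborel)
     = (\<integral>z. mono_form f e (- e) / 2 * cap r z + 2 * (cap r z * (f z \<bullet> z)) - cap r z * ((f e + f (- e)) \<bullet> z) \<partial>lborel)"
    by simp
  also have "\<dots> = mono_form f e (- e) / 2 * (\<integral>z. cap r (z::'a) \<partial>lborel) + 2 * (\<integral>z. cap r z * (f z \<bullet> z) \<partial>lborel)
      - (\<integral>z. cap r z * ((f e + f (- e)) \<bullet> z) \<partial>lborel)"
    using i1 i2 i3 by simp
  finally show ?thesis
    using integral_cap_inner[OF r, of "f e + f (- e)"] integral_cap_radial[OF P r] by simp
qed

section \<open>Tension in a bundle of cables\<close>

text \<open>The argument of \<^term>\<open>cap r\<close> on the right is the end \<^term>\<open>z\<close> of the cable that starts at \<open>- e\<close> and passes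
  through \<^term>\<open>y\<close> at the parameter \<^term>\<open>t\<close> counted from \<^term>\<open>z\<close>. Leaving \<^term>\<open>y\<close> in the direction
  away from \<open>- e\<close> with \<open>y \<bullet> e \<le> 0\<close>, one moves towards the hyperplane orthogonal to \<^term>\<open>e\<close>
  through \<open>0\<close>, so that to first order in \<^term>\<open>t\<close> the distance to \<open>0\<close> grows only through the spreading of
  the cables. Hence half of the weight is still there for a time proportional to \<open>cap r y / r\<close>.\<close>
lemma cap_along_cable:
  fixes y e :: "'a::real_inner"
  assumes r: "0 < r" "r \<le> 1/2" and e: "norm e = 1" and y: "y \<bullet> e \<le> 0"
    and t: "0 \<le> t" "t \<le> cap r y / (16 * r)"
  shows "t \<le> 1/2" "cap r y / 2 \<le> cap r ((1 / (1 - t)) *\<^sub>R (y + t *\<^sub>R e))"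
proof -
  define h where "h = cap r y"
  have h: "0 \<le> h" "h \<le> r\<^sup>2" by (auto simp: h_def cap_nonneg cap_le)
  have "h / (16 * r) \<le> r\<^sup>2 / (16 * r)" using h r by (simp add: divide_right_mono)
  then have tr: "t \<le> r / 16" using t h_def r by (simp add: power2_eq_square)
  then show t2: "t \<le> 1/2" using r by simp
  show "cap r y / 2 \<le> cap r ((1 / (1 - t)) *\<^sub>R (y + t *\<^sub>R e))"
  proof (cases "h = 0")
    case True
    then show ?thesis using cap_nonneg h_def by simp
  next
    case False
    then have hy: "h = r\<^sup>2 - y \<bullet> y" using h by (auto simp: h_def cap_def max_def split: if_splits)
    \<comment> \<open>The bound is an equality at \<open>t = 0\<close> and at \<open>t = 1/2\<close>, and the left side is convex.\<close>
    have s: "1 / (1 - t)\<^sup>2 \<le> 1 + 6 * t"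
    proof -
      have "1 \<le> (1 + 6 * t) * (1 - t)\<^sup>2"
      proof -
        have "(1 + 6 * t) * (1 - t)\<^sup>2 - 1 = t * (1 - 2 * t) * (4 - 3 * t)"
          by (simp add: power2_eq_square algebra_simps)
        moreover have "\<dots> \<ge> 0" using t t2 by auto
        ultimately show ?thesis by simp
      qed
      then show ?thesis using t2 by (simp add: divide_le_eq)
    qed
    have e2: "e \<bullet> e = 1" using e by (simp add: dot_square_norm)
    have "(y + t *\<^sub>R e) \<bullet> (y + t *\<^sub>R e) = y \<bullet> y + 2 * t * (y \<bullet> e) + t\<^sup>2"
      by (simp add: inner_add inner_commute e2 power2_eq_square algebra_simps)
    also have "\<dots> \<le> y \<bullet> y + t\<^sup>2" using t y by (simp add: mult_nonneg_nonpos)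
    finally have "((1 / (1 - t)) *\<^sub>R (y + t *\<^sub>R e)) \<bullet> ((1 / (1 - t)) *\<^sub>R (y + t *\<^sub>R e)) \<le> (1 / (1 - t)\<^sup>2) * (y \<bullet> y + t\<^sup>2)"
      using t2 by (simp add: power2_eq_square divide_right_mono)
    also have "\<dots> \<le> (1 + 6 * t) * (y \<bullet> y + t\<^sup>2)"
      using s by (intro mult_right_mono) auto
    also have "\<dots> = y \<bullet> y + 6 * t * (y \<bullet> y) + (1 + 6 * t) * t\<^sup>2" by (simp add: algebra_simps)
    also have "\<dots> \<le> y \<bullet> y + 6 * t * r\<^sup>2 + 4 * t\<^sup>2"
      using hy h t t2 by (intro add_mono mult_left_mono mult_right_mono) auto
    also have "\<dots> \<le> y \<bullet> y + h / 2"
    proof -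
      have th: "16 * (t * r) \<le> h" using t r by (simp add: h_def field_simps)
      have "6 * t * r\<^sup>2 \<le> 3 * (t * r)" 
      proof -
        have "r * r \<le> 1/2 * r" using r by (intro mult_right_mono) auto
        then have "6 * t * (r * r) \<le> 6 * t * (1/2 * r)" using t by (intro mult_left_mono) auto
        then show ?thesis by (simp add: power2_eq_square)
      qed
      moreover have "4 * t\<^sup>2 \<le> 4 * (t * r)" using tr t r by (simp add: power2_eq_square mult_left_mono)
      moreover have "0 \<le> t * r" using t r by simp
      ultimately show ?thesis using th by linarith
    qed
    finally have "r\<^sup>2 - ((1 / (1 - t)) *\<^sub>R (y + t *\<^sub>R e)) \<bullet> ((1 / (1 - t)) *\<^sub>R (y + t *\<^sub>R e)) \<ge> h / 2"
      using hy by linarith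
    then have "h / 2 \<le> cap r ((1 / (1 - t)) *\<^sub>R (y + t *\<^sub>R e))"
      unfolding cap_def by (rule max.coboundedI2)
    then show ?thesis by (simp add: h_def)
  qed
qed

text \<open>Lower bound for the tension of the bundle of cables that join \<open>- e\<close> to the points of the ball of
  radius \<^term>\<open>r\<close>. By Tonelli and the substitution \<open>y = z - t (z + e)\<close> the density of the bundle at \<^term>\<open>y\<close>
  is at least the integral over \<open>t\<close> of the weight at the point \<open>z\<close> where the cable ends. That weight is at least
  \<open>cap r y / 2\<close> for a time of order \<open>cap r y / r\<close>, so the density is of order \<open>(cap r y)\<^sup>2 / r\<close>: it has
  the same shape as the density in \<^emph>\<open>integral_cap_mono_form\<close> but carries the large factor \<open>1 / r\<close>.
  Only the half of the ball facing \<open>- e\<close> is covered; the bundle from \<^term>\<open>e\<close> covers the other half.\<close>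
lemma nn_integral_cap_mono_form_half_space:
  fixes f :: "'a::euclidean_space \<Rightarrow> 'a"
  assumes P: "pinched c f A" and c: "0 \<le> c" and r: "0 < r" "r \<le> 1/2" and e: "norm e = 1"
  shows "(\<integral>\<^sup>+y. ennreal (c / (32 * r) * ((cap r y)\<^sup>2 / 4 * trace_of (A y))) * indicator {y. y \<bullet> e \<le> 0} y \<partial>lborel)
    \<le> (\<integral>\<^sup>+z. ennreal (cap r z * mono_form f z (- e)) \<partial>lborel)"
proof -
  define D where "D y = trace_of (A y)" for y
  have D0: "0 \<le> D y" for y unfolding D_def by (rule pinched_trace_nonneg[OF P])
  have contD: "continuous_on UNIV D" unfolding D_def[abs_def] by (rule pinched_continuous_trace[OF P])
  have [measurable]: "D \<in> borel_measurable borel" "cap r \<in> borel_measurable (borel :: 'a measure)"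
    by (intro borel_measurable_continuous_onI contD continuous_on_cap)+
  define \<Psi> where "\<Psi> z t = ennreal (c / 4 * (cap r z * D (z - t *\<^sub>R (z + e)))) * indicator {0..1/2::real} t" for z t
  have [measurable]: "case_prod \<Psi> \<in> borel_measurable (lborel \<Otimes>\<^sub>M lborel)"
    unfolding \<Psi>_def by measurable
  have "(\<integral>\<^sup>+y. ennreal (c / (32 * r) * ((cap r y)\<^sup>2 / 4 * trace_of (A y))) * indicator {y. y \<bullet> e \<le> 0} y \<partial>lborel)
     \<le> (\<integral>\<^sup>+y. (\<integral>\<^sup>+t. \<Psi> ((1 / (1 - t)) *\<^sub>R (y + t *\<^sub>R e)) t \<partial>lborel) \<partial>lborel)"
  proof (rule nn_integral_mono)
    fix y :: 'a
    define h where "h = cap r y"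
    have h0: "0 \<le> h" by (simp add: h_def cap_nonneg)
    show "ennreal (c / (32 * r) * ((cap r y)\<^sup>2 / 4 * trace_of (A y))) * indicator {y. y \<bullet> e \<le> 0} y
       \<le> (\<integral>\<^sup>+t. \<Psi> ((1 / (1 - t)) *\<^sub>R (y + t *\<^sub>R e)) t \<partial>lborel)"
    proof (cases "y \<bullet> e \<le> 0")
      case True
      have "ennreal (c / (32 * r) * ((cap r y)\<^sup>2 / 4 * trace_of (A y)))
          = ennreal (c / 4 * (h / 2 * D y)) * ennreal (h / (16 * r))"
        using c r h0 D0 by (subst ennreal_mult[symmetric])
          (auto simp: h_def D_def power2_eq_square field_simps)
      also have "\<dots> = (\<integral>\<^sup>+t. ennreal (c / 4 * (h / 2 * D y)) * indicator {0..h / (16 * r)} t \<partial>lborel)"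
        using h0 r by (simp add: nn_integral_cmult_indicator)
      also have "\<dots> \<le> (\<integral>\<^sup>+t. \<Psi> ((1 / (1 - t)) *\<^sub>R (y + t *\<^sub>R e)) t \<partial>lborel)"
      proof (rule nn_integral_mono)
        fix t :: real
        show "ennreal (c / 4 * (h / 2 * D y)) * indicator {0..h / (16 * r)} t
           \<le> \<Psi> ((1 / (1 - t)) *\<^sub>R (y + t *\<^sub>R e)) t"
        proof (cases "t \<in> {0..h / (16 * r)}")
          case t: True
          define z where "z = (1 / (1 - t)) *\<^sub>R (y + t *\<^sub>R e)"
          have t2: "t \<le> 1/2" and hz: "h / 2 \<le> cap r z"
            using cap_along_cable[OF r e True, of t] t by (auto simp: h_def z_def)
          have "(1 - t) *\<^sub>R z = y + t *\<^sub>R e" using t2 by (simp add: z_def)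
          then have "z - t *\<^sub>R (z + e) = y" by (simp add: algebra_simps)
          moreover have "c / 4 * (h / 2 * D y) \<le> c / 4 * (cap r z * D y)"
            using hz c D0[of y] by (intro mult_left_mono mult_right_mono) auto
          ultimately show ?thesis
            using t t2 unfolding \<Psi>_def z_def[symmetric] by (simp only:) (auto intro: ennreal_leI)
        qed simp
      qed
      finally show ?thesis using True by simp
    qed simp
  qed
  also have "\<dots> = (\<integral>\<^sup>+t. (\<integral>\<^sup>+y. \<Psi> ((1 / (1 - t)) *\<^sub>R (y + t *\<^sub>R e)) t \<partial>lborel) \<partial>lborel)"
    by (rule lborel_pair.Fubini') (simp add: \<Psi>_def; measurable)
  also have "\<dots> \<le> (\<integral>\<^sup>+t. (\<integral>\<^sup>+z. \<Psi> z t \<partial>lborel) \<partial>lborel)"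
  proof (rule nn_integral_mono)
    fix t :: real
    show "(\<integral>\<^sup>+y. \<Psi> ((1 / (1 - t)) *\<^sub>R (y + t *\<^sub>R e)) t \<partial>lborel) \<le> (\<integral>\<^sup>+z. \<Psi> z t \<partial>lborel)"
    proof (cases "t \<in> {0..1/2}")
      case True
      have "(\<lambda>z. \<Psi> z t) \<in> borel_measurable borel" unfolding \<Psi>_def by measurable
      from nn_integral_affine_expansion_le[OF this, of "1 / (1 - t)" "(1 / (1 - t)) *\<^sub>R (t *\<^sub>R e)"] True
      show ?thesis by (simp add: scaleR_add_right add.commute)
    qed (simp add: \<Psi>_def)
  qed
  also have "\<dots> = (\<integral>\<^sup>+z. (\<integral>\<^sup>+t. \<Psi> z t \<partial>lborel) \<partial>lborel)"
    by (rule lborel_pair.Fubini'[symmetric]) measurable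
  also have "\<dots> \<le> (\<integral>\<^sup>+z. ennreal (cap r z * mono_form f z (- e)) \<partial>lborel)"
  proof (rule nn_integral_mono)
    fix z :: 'a
    show "(\<integral>\<^sup>+t. \<Psi> z t \<partial>lborel) \<le> ennreal (cap r z * mono_form f z (- e))"
    proof (cases "norm z \<le> r")
      case False
      then have "cap r z = 0" using cap_eq_0[of r z] r by simp
      then show ?thesis by (simp add: \<Psi>_def)
    next
      case True
      have "1 \<le> norm z + norm (z + e)"
        using norm_triangle_ineq4[of "z + e" z] e by simp
      then have "1/2 \<le> norm (z + e)" using True r by simp
      then have "(1/2)\<^sup>2 \<le> (norm (z + e))\<^sup>2" by (intro power_mono) auto
      then have n: "1/4 \<le> (norm (z - - e))\<^sup>2" by (simp add: power2_eq_square)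
      have "(\<integral>\<^sup>+t. \<Psi> z t \<partial>lborel) \<le> (\<integral>\<^sup>+t. ennreal (cap r z) *
         (ennreal (c * (norm (z - - e))\<^sup>2 * trace_of (A (z - t *\<^sub>R (z - - e)))) * indicator {0..1/2} t) \<partial>lborel)"
      proof (rule nn_integral_mono)
        fix t :: real
        define d where "d = D (z - t *\<^sub>R (z + e))"
        have "c * (1 / 4) * d \<le> c * (norm (z - - e))\<^sup>2 * d"
          using n c D0 by (intro mult_right_mono mult_left_mono) (auto simp: d_def)
        from mult_left_mono[OF this cap_nonneg[of r z]]
        have "c / 4 * (cap r z * d) \<le> cap r z * (c * (norm (z - - e))\<^sup>2 * d)"
          by (simp add: mult_ac)
        then show "\<Psi> z t \<le> ennreal (cap r z) * (ennreal (c * (norm (z - - e))\<^sup>2 * trace_of (A (z - t *\<^sub>R (z - - e)))) * indicator {0..1/2} t)"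
          using cap_nonneg[of r z] by (auto simp: \<Psi>_def d_def D_def indicator_def ennreal_mult'[symmetric] intro: ennreal_leI)
      qed
      also have "\<dots> = ennreal (cap r z) * (\<integral>\<^sup>+t. 
         ennreal (c * (norm (z - - e))\<^sup>2 * trace_of (A (z - t *\<^sub>R (z - - e)))) * indicator {0..1/2} t \<partial>lborel)"
        unfolding D_def[symmetric] by (rule nn_integral_cmult) measurable
      also have "\<dots> \<le> ennreal (cap r z) * ennreal (mono_form f z (- e))"
        by (intro mult_left_mono pinched_mono_form_ge_trace_integral[OF P c]) simp
      finally show ?thesis by (simp add: ennreal_mult' cap_nonneg)
    qed
  qed
  finally show ?thesis .
qed

section \<open>The kink bound\<close>

text \<open>If \<open>\<alpha>\<^sub>p\<close> are coefficients with \<open>\<Sum> \<alpha>\<^sub>p = 0\<close> and \<open>\<Sum> \<alpha>\<^sub>p p = 0\<close>, then expanding the form gives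
  \<open>(\<Sum> \<alpha>\<^sub>p f p) \<bullet> w = \<Sum> \<alpha>\<^sub>p (mono_form f p 0 - mono_form f p w)\<close>. Here the points are
  \<open>u = (2 l - 1) e\<close>, \<open>- e\<close> and \<open>e\<close> with coefficients \<open>1\<close>, \<open>l - 1\<close> and \<open>- l\<close>; by monotonicity all terms with a
  negative sign may be dropped, and \<open>mono_form f u 0\<close> is controlled along the line.\<close>
lemma kink_inner_le:
  assumes mono: "\<And>x y. 0 \<le> mono_form f x y" and l: "0 \<le> l" "l \<le> 1"
  shows "(f ((2 * l - 1) *\<^sub>R e) - (1 - l) *\<^sub>R f (- e) - l *\<^sub>R f e) \<bullet> w
    \<le> mono_form f e (- e) + (mono_form f w e + mono_form f w (- e))"
proof -
  define \<mu> where "\<mu> = 2 * l - 1"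
  define g where "g t = f (t *\<^sub>R e) \<bullet> e" for t
  have gm: "g s \<le> g t" if "s < t" for s t
  proof -
    have "mono_form f (t *\<^sub>R e) (s *\<^sub>R e) = (t - s) * (g t - g s)"
      by (simp add: mono_form_def g_def inner_diff algebra_simps)
    then show ?thesis using mono[of "t *\<^sub>R e" "s *\<^sub>R e"] that by (simp add: zero_le_mult_iff)
  qed
  then have gm: "g s \<le> g t" if "s \<le> t" for s t using that by (cases "s = t") auto
  have \<mu>: "\<bar>\<mu>\<bar> \<le> 1" "- 1 \<le> \<mu>" "\<mu> \<le> 1" using l by (auto simp: \<mu>_def)
  have ends: "mono_form f e (- e) = 2 * (g 1 - g (-1))"
    by (simp add: mono_form_def g_def inner_diff algebra_simps)
  have "mono_form f (\<mu> *\<^sub>R e) 0 = \<mu> * (g \<mu> - g 0)"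
    by (simp add: mono_form_def g_def inner_diff algebra_simps)
  also have "\<dots> \<le> \<bar>\<mu>\<bar> * \<bar>g \<mu> - g 0\<bar>" by (metis abs_ge_self abs_mult)
  also have "\<dots> \<le> 1 * (g 1 - g (-1))"
    using \<mu> gm[of "-1" \<mu>] gm[of \<mu> 1] gm[of "-1" 0] gm[of 0 1]
    by (intro mult_mono) auto
  also have "\<dots> \<le> mono_form f e (- e)" using gm[of "-1" 1] by (simp add: ends)
  finally have u0: "mono_form f (\<mu> *\<^sub>R e) 0 \<le> mono_form f e (- e)" .
  have "(f (\<mu> *\<^sub>R e) - (1 - l) *\<^sub>R f (- e) - l *\<^sub>R f e) \<bullet> w
     = (mono_form f (\<mu> *\<^sub>R e) 0 - mono_form f (\<mu> *\<^sub>R e) w)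
       - (1 - l) * (mono_form f (- e) 0 - mono_form f (- e) w) - l * (mono_form f e 0 - mono_form f e w)"
    by (simp add: mono_form_def \<mu>_def inner_diff inner_add algebra_simps)
  also have "\<dots> \<le> mono_form f (\<mu> *\<^sub>R e) 0 + ((1 - l) * mono_form f (- e) w + l * mono_form f e w)"
    using l mono[of "\<mu> *\<^sub>R e" w] mult_nonneg_nonneg[OF _ mono[of "-e" 0], of "1 - l"]
      mult_nonneg_nonneg[OF _ mono[of e 0], of l] by (simp add: right_diff_distrib)
  also have "\<dots> \<le> mono_form f e (- e) + (1 * mono_form f (- e) w + 1 * mono_form f e w)"
    using l u0 mono by (intro add_mono mult_right_mono) auto
  finally show ?thesis
    by (simp add: \<mu>_def mono_form_commute[of f w] add_ac)
qed

text \<open>The radius is chosen so small that the tension of the two bundles, \<open>c / (32 r)\<close> times an integral,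
  is at least four times that same integral, whereas the balance of forces charges only twice the
  integral. The remainder gives \<open>\<integral> cap r z * G z \<le> T * \<integral> cap r z\<close>, where \<open>T\<close> is the form at the two ends
  and \<open>G\<close> is the sum of the forms between \<open>z\<close> and the ends. Testing the kink vector against points
  \<open>w\<close> near its own direction and averaging bounds its length by a multiple of \<open>T\<close>.\<close>
lemma pinched_kink_bound_unit:
  assumes c: "0 < c"
  shows "\<exists>C. \<forall>(f :: 'a::euclidean_space \<Rightarrow> 'a) A e l. pinched c f A \<longrightarrow> norm e = 1 \<longrightarrow> 0 \<le> l \<longrightarrow> l \<le> 1 \<longrightarrow>
    norm (f ((2 * l - 1) *\<^sub>R e) - (1 - l) *\<^sub>R f (- e) - l *\<^sub>R f e) \<le> C * mono_form f e (- e)"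
proof -
  define r where "r = min (1/2) (c / 128)"
  have r: "0 < r" "r \<le> 1/2" "128 * r \<le> c" using c by (auto simp: r_def)
  define V where "V = (\<integral>z. cap r (z::'a) \<partial>lborel)"
  define m where "m = unit_ball_vol (DIM('a)) * (r / 4) ^ DIM('a)"
  have m: "m > 0" using r by (simp add: m_def)
  have "norm (f ((2 * l - 1) *\<^sub>R e) - (1 - l) *\<^sub>R f (- e) - l *\<^sub>R f e) \<le> (32 * V / (r ^ 3 * m)) * mono_form f e (- e)"
    if P: "pinched c f A" and e: "norm e = 1" and l: "0 \<le> l" "l \<le> 1" for f :: "'a \<Rightarrow> 'a" and A e l
  proof -
    define T where "T = mono_form f e (- e)"
    define G where "G z = mono_form f z e + mono_form f z (- e)" for z
    define Q where "Q z = (cap r z)\<^sup>2 / 4 * trace_of (A z)" for z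
    define I where "I = (\<integral>z. cap r z * G z \<partial>lborel)"
    define k where "k = f ((2 * l - 1) *\<^sub>R e) - (1 - l) *\<^sub>R f (- e) - l *\<^sub>R f e"
    have mono: "0 \<le> mono_form f x y" for x y by (rule pinched_mono_form_nonneg[OF P])
    have T0: "0 \<le> T" and G0: "\<And>z. 0 \<le> G z" unfolding T_def G_def by (simp_all add: mono)
    have Q0: "0 \<le> Q z" for z unfolding Q_def using pinched_trace_nonneg[OF P] by simp
    have int: "integrable lborel F" if "continuous_on UNIV F" "\<And>z. cap r z = 0 \<Longrightarrow> F z = 0" for F :: "'a \<Rightarrow> real"
      using integrable_continuous_bounded_support[OF that(1), of "cball 0 r"] that(2) cap_eq_0[of r] r
      by (metis bounded_cball less_imp_le)
    have contT: "continuous_on UNIV (\<lambda>z. mono_form f z a)" for a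
      unfolding mono_form_def by (intro continuous_intros pinched_continuous[OF P])
    have contG: "continuous_on UNIV G"
      unfolding G_def by (intro continuous_intros contT)
    have contQ: "continuous_on UNIV Q"
      unfolding Q_def[abs_def]
      by (intro continuous_on_mult continuous_on_divide continuous_on_power continuous_on_const
          continuous_on_cap pinched_continuous_trace[OF P]) auto
    have intG: "integrable lborel (\<lambda>z. cap r z * G z)"
      by (rule int) (auto intro!: continuous_on_mult continuous_on_cap contG)
    have intcap: "integrable lborel (\<lambda>z::'a. cap r z)"
      by (rule int) (auto intro!: continuous_on_cap)
    have intQ: "integrable lborel Q"
      by (rule int[OF contQ]) (simp add: Q_def)
    have [measurable]: "Q \<in> borel_measurable borel" "(\<lambda>z. mono_form f z a) \<in> borel_measurable borel"
      "cap r \<in> borel_measurable (borel :: 'a measure)" for a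
      by (intro borel_measurable_continuous_onI contQ contT continuous_on_cap)+
    \<comment> \<open>The two half spaces cover everything, so the two bundles together control the whole integral.\<close>
    have "ennreal (c / (32 * r) * integral\<^sup>L lborel Q) = (\<integral>\<^sup>+z. ennreal (c / (32 * r) * Q z) \<partial>lborel)"
      using nn_integral_eq_integral[OF integrable_mult_right[OF intQ, of "c / (32 * r)"]] c r Q0 by simp
    also have "\<dots> \<le> (\<integral>\<^sup>+z. ennreal (c / (32 * r) * Q z) * indicator {y. y \<bullet> (- e) \<le> 0} z
        + ennreal (c / (32 * r) * Q z) * indicator {y. y \<bullet> e \<le> 0} z \<partial>lborel)"
      by (rule nn_integral_mono) (auto simp: indicator_def)
    also have "\<dots> = (\<integral>\<^sup>+z. ennreal (c / (32 * r) * Q z) * indicator {y. y \<bullet> (- e) \<le> 0} z \<partial>lborel)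
        + (\<integral>\<^sup>+z. ennreal (c / (32 * r) * Q z) * indicator {y. y \<bullet> e \<le> 0} z \<partial>lborel)"
      by (rule nn_integral_add) measurable
    also have "\<dots> \<le> (\<integral>\<^sup>+z. ennreal (cap r z * mono_form f z e) \<partial>lborel)
        + (\<integral>\<^sup>+z. ennreal (cap r z * mono_form f z (- e)) \<partial>lborel)"
      using nn_integral_cap_mono_form_half_space[OF P _ r(1,2), of e] c e
        nn_integral_cap_mono_form_half_space[OF P _ r(1,2), of "- e"]
      unfolding Q_def by (intro add_mono) auto
    also have "\<dots> = (\<integral>\<^sup>+z. ennreal (cap r z * mono_form f z e) + ennreal (cap r z * mono_form f z (- e)) \<partial>lborel)"
      by (rule nn_integral_add[symmetric]) measurable
    also have "\<dots> = (\<integral>\<^sup>+z. ennreal (cap r z * G z) \<partial>lborel)"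
      by (intro nn_integral_cong) (simp add: G_def distrib_left mono cap_nonneg)
    also have "\<dots> = ennreal I"
      unfolding I_def by (rule nn_integral_eq_integral[OF intG]) (simp add: cap_nonneg G0)
    finally have "c / (32 * r) * integral\<^sup>L lborel Q \<le> I"
      by (subst (asm) ennreal_le_iff) (auto simp: I_def cap_nonneg G0)
    moreover have "4 \<le> c / (32 * r)" using r by (simp add: field_simps)
    moreover have "0 \<le> integral\<^sup>L lborel Q" using Q0 by simp
    ultimately have "4 * integral\<^sup>L lborel Q \<le> I"
      by (meson mult_right_mono order_trans)
    moreover have I: "I = T / 2 * V + 2 * integral\<^sup>L lborel Q"
      unfolding I_def T_def V_def Q_def G_def using integral_cap_mono_form[OF P, of r e] r by simp
    ultimately have IV: "I \<le> T * V" by simp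
    have key: "r ^ 3 / 16 * norm k * m \<le> 2 * T * V"
    proof (cases "k = 0")
      case True
      have "0 \<le> V" by (simp add: V_def cap_nonneg)
      with True T0 show ?thesis by simp
    next
      case False
      \<comment> \<open>The ball of radius \<open>r / 4\<close> about this point lies where \<open>cap r\<close> is at least \<open>r\<^sup>2 / 4\<close>.\<close>
      define w0 where "w0 = (r / (2 * norm k)) *\<^sub>R k"
      have nw0: "norm w0 = r / 2" and kw0: "k \<bullet> w0 = norm k * r / 2" using False r
        by (auto simp: w0_def dot_square_norm power2_eq_square)
      have low: "indicator (ball w0 (r / 4)) w * (r ^ 3 / 16 * norm k) \<le> cap r w * (T + G w)" for w
      proof (cases "w \<in> ball w0 (r / 4)")
        case True
        then have nd: "norm (w - w0) < r / 4" by (simp add: dist_norm norm_minus_commute)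
        have "\<bar>k \<bullet> (w - w0)\<bar> \<le> norm k * norm (w - w0)" by (rule Cauchy_Schwarz_ineq2)
        also have "\<dots> \<le> norm k * (r / 4)" using nd by (intro mult_left_mono) auto
        finally have "norm k * (r / 4) \<le> k \<bullet> w" using kw0 unfolding inner_diff_right by linarith
        also have "k \<bullet> w \<le> T + G w"
          unfolding k_def T_def G_def by (rule kink_inner_le[OF mono l])
        finally have 1: "norm k * (r / 4) \<le> T + G w" .
        have "norm w \<le> norm w0 + norm (w - w0)" by (metis norm_triangle_sub)
        then have "norm w \<le> 3/4 * r" using nd nw0 by simp
        then have "(norm w)\<^sup>2 \<le> (3/4 * r)\<^sup>2" by (intro power_mono) auto
        then have "(norm w)\<^sup>2 \<le> 9/16 * r\<^sup>2" by (simp add: power2_eq_square)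
        then have "r\<^sup>2 / 4 \<le> r\<^sup>2 - w \<bullet> w"
          unfolding dot_square_norm using zero_le_power2[of r] by linarith
        then have "r\<^sup>2 / 4 \<le> cap r w" unfolding cap_def by (rule max.coboundedI2)
        then have "r\<^sup>2 / 4 * (norm k * (r / 4)) \<le> cap r w * (T + G w)"
          using 1 r cap_nonneg by (intro mult_mono) auto
        then show ?thesis using True by (simp add: power2_eq_square power3_eq_cube mult_ac)
      next
        case False
        then show ?thesis using T0 G0[of w] cap_nonneg[of r w] by simp
      qed
      have "r ^ 3 / 16 * norm k * m = (\<integral>w. indicator (ball w0 (r / 4)) w * (r ^ 3 / 16 * norm k) \<partial>lborel)"
        using r by (simp add: m_def content_ball)
      also have "\<dots> \<le> (\<integral>w. cap r w * (T + G w) \<partial>lborel)"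
      proof (rule integral_mono)
        show "integrable lborel (\<lambda>w. indicator (ball w0 (r / 4)) w * (r ^ 3 / 16 * norm k))"
          by (intro integrable_mult_left integrable_real_indicator emeasure_lborel_ball_finite) simp
        show "integrable lborel (\<lambda>w. cap r w * (T + G w))"
          using intG intcap by (simp add: distrib_left)
      qed (use low in auto)
      also have "\<dots> = T * V + I"
        using intG intcap by (simp add: distrib_left V_def I_def mult.commute)
      finally show ?thesis using IV by simp
    qed
    have "norm k = r ^ 3 / 16 * norm k * m * (16 / (r ^ 3 * m))" using r m by simp
    also have "\<dots> \<le> 2 * T * V * (16 / (r ^ 3 * m))"
      using key r m by (intro mult_right_mono) auto
    finally show ?thesis unfolding k_def T_def by (simp add: mult_ac)
  qed
  then show ?thesis by blast
qed

text \<open>Affine changes of variable reduce the estimate on a general segment to the segment from \<open>- e\<close> to \<open>e\<close>.\<close>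
lemma pinched_rescale:
  assumes P: "pinched c f A" and R: "0 \<le> R"
  shows "pinched c (\<lambda>x. f (q + R *\<^sub>R x)) (\<lambda>x v. R *\<^sub>R A (q + R *\<^sub>R x) v)"
  unfolding pinched_def
proof (intro conjI allI)
  have lin: "linear (A x)" for x by (rule pinched_linear[OF P])
  show "((\<lambda>t. f (q + R *\<^sub>R (x + t *\<^sub>R v))) has_vector_derivative R *\<^sub>R A (q + R *\<^sub>R (x + t *\<^sub>R v)) v) (at t)" for x v t
    using pinched_deriv[OF P, of "q + R *\<^sub>R x" "R *\<^sub>R v" t]
    by (simp add: scaleR_add_right linear_scale[OF lin] mult.commute add.assoc)
  show "continuous_on UNIV (\<lambda>x. f (q + R *\<^sub>R x))"
    by (intro continuous_on_compose2[OF pinched_continuous[OF P]] continuous_intros) auto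
  show "continuous_on UNIV (\<lambda>x. R *\<^sub>R A (q + R *\<^sub>R x) v)" for v
    by (intro continuous_on_scaleR continuous_on_const continuous_on_compose2[OF pinched_continuous_deriv[OF P]] continuous_intros) auto
  show "linear (\<lambda>v. R *\<^sub>R A (q + R *\<^sub>R x) v)" for x
    using lin by (rule linear_compose_scale_right)
  show "0 \<le> R *\<^sub>R A (q + R *\<^sub>R x) v \<bullet> v" for x v
    using pinched_nonneg[OF P] R by simp
  have tr: "trace_of (\<lambda>v. R *\<^sub>R L v) = R * trace_of L" for L :: "'a \<Rightarrow> 'a"
    by (simp add: trace_of_def sum_distrib_left)
  show "c * trace_of (\<lambda>v. R *\<^sub>R A (q + R *\<^sub>R x) v) * (norm v)\<^sup>2 \<le> R *\<^sub>R A (q + R *\<^sub>R x) v \<bullet> v" for x v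
    using mult_left_mono[OF pinched_lower[OF P, of "q + R *\<^sub>R x" v] R] by (simp add: tr mult_ac)
qed

text \<open>The deviation of a pinched field from the affine interpolation on a segment is controlled by the
  increment of its component along that segment. The constant does not depend on the field, and the
  inequality involves only three values of it.\<close>
lemma pinched_kink_bound:
  assumes c: "0 < c"
  shows "\<exists>C. \<forall>(f :: 'a::euclidean_space \<Rightarrow> 'a) A x y l. pinched c f A \<longrightarrow> 0 \<le> l \<longrightarrow> l \<le> 1 \<longrightarrow>
    norm (f (x + l *\<^sub>R (y - x)) - (1 - l) *\<^sub>R f x - l *\<^sub>R f y) * norm (y - x) \<le> C * mono_form f y x"
proof -
  obtain C where C: "\<And>(f :: 'a \<Rightarrow> 'a) A e l. \<lbrakk>pinched c f A; norm e = 1; 0 \<le> l; l \<le> 1\<rbrakk> \<Longrightarrow>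
    norm (f ((2 * l - 1) *\<^sub>R e) - (1 - l) *\<^sub>R f (- e) - l *\<^sub>R f e) \<le> C * mono_form f e (- e)"
    using pinched_kink_bound_unit[OF c] by blast
  have "norm (f (x + l *\<^sub>R (y - x)) - (1 - l) *\<^sub>R f x - l *\<^sub>R f y) * norm (y - x) \<le> (2 * C) * mono_form f y x"
    if P: "pinched c f A" and l: "0 \<le> l" "l \<le> 1" for f :: "'a \<Rightarrow> 'a" and A x y l
  proof (cases "x = y")
    case True
    then show ?thesis by (simp add: mono_form_def)
  next
    case False
    define R where "R = norm (y - x) / 2"
    have R: "R > 0" using False by (simp add: R_def)
    define e where "e = (1 / (2 * R)) *\<^sub>R (y - x)"
    define q where "q = (1/2) *\<^sub>R (x + y)"
    define F where "F z = f (q + R *\<^sub>R z)" for z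
    have e: "norm e = 1" using False by (simp add: e_def R_def)
    have Re: "R *\<^sub>R e = (1/2) *\<^sub>R (y - x)" using R by (simp add: e_def)
    have at: "q + R *\<^sub>R ((2 * l - 1) *\<^sub>R e) = x + l *\<^sub>R (y - x)" for l
    proof -
      have "q + R *\<^sub>R ((2 * l - 1) *\<^sub>R e) = q + (2 * l - 1) *\<^sub>R (R *\<^sub>R e)" by (simp add: mult.commute)
      also have "\<dots> = x + l *\<^sub>R (y - x)" unfolding Re q_def
        by (simp add: algebra_simps flip: scaleR_add_left)
      finally show ?thesis .
    qed
    have Fl: "F ((2 * l - 1) *\<^sub>R e) = f (x + l *\<^sub>R (y - x))" for l
      unfolding F_def at ..
    have Fe: "F (- e) = f x" "F e = f y" using Fl[of 0] Fl[of 1] by simp_all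
    have MF: "mono_form F e (- e) * R = mono_form f y x"
    proof -
      have "mono_form F e (- e) * R = (f y - f x) \<bullet> (2 *\<^sub>R (R *\<^sub>R e))"
        unfolding mono_form_def Fe by (simp add: inner_simps)
      then show ?thesis unfolding Re mono_form_def by simp
    qed
    have "norm (f (x + l *\<^sub>R (y - x)) - (1 - l) *\<^sub>R f x - l *\<^sub>R f y) \<le> C * mono_form F e (- e)"
      using C[OF pinched_rescale[OF P, of R q, folded F_def] e l] R unfolding Fl Fe by simp
    then have "norm (f (x + l *\<^sub>R (y - x)) - (1 - l) *\<^sub>R f x - l *\<^sub>R f y) * norm (y - x)
        \<le> C * mono_form F e (- e) * norm (y - x)"
      by (rule mult_right_mono) simp
    moreover have "norm (y - x) = 2 * R" by (simp add: R_def)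
    ultimately show ?thesis using MF by (simp add: mult_ac)
  qed
  then show ?thesis by blast
qed

section \<open>Smooth kernels\<close>

text \<open>Every derivative of the standard flat function \<open>exp (- 1 / t)\<close> is of this form.\<close>
definition flat :: "real poly \<Rightarrow> real \<Rightarrow> real" where
  "flat p t = (if 0 < t then poly p (1 / t) * exp (- (1 / t)) else 0)"

definition flat_pderiv :: "real poly \<Rightarrow> real poly" where
  "flat_pderiv p = monom 1 2 * (p - pderiv p)"

lemma tendsto_poly_exp_neg: "((\<lambda>x. poly p x * exp (- x)) \<longlongrightarrow> (0::real)) at_top"
proof -
  have "poly p x * exp (- x) = (\<Sum>i\<le>degree p. coeff p i * (x ^ i / exp x))" for x
    by (simp add: poly_altdef exp_minus sum_distrib_left sum_distrib_right divide_inverse mult_ac)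
  moreover have "((\<lambda>x. \<Sum>i\<le>degree p. coeff p i * (x ^ i / exp x)) \<longlongrightarrow> (\<Sum>i\<le>degree p. coeff p i * 0)) at_top"
    by (intro tendsto_intros tendsto_power_div_exp_0)
  ultimately show ?thesis by simp
qed

lemma DERIV_flat: "(flat p has_real_derivative flat (flat_pderiv p) t) (at t)"
proof -
  consider "t < 0" | "t = 0" | "t > 0" by linarith
  then show ?thesis
  proof cases
    case 1
    have "((\<lambda>s. 0) has_real_derivative flat (flat_pderiv p) t) (at t)" using 1 by (simp add: flat_def)
    then show ?thesis
      by (rule has_field_derivative_transform_within_open[of _ _ _ "{..<0}"]) (use 1 in \<open>auto simp: flat_def\<close>)
  next
    case 2
    have "((\<lambda>h. flat p h / h) \<longlongrightarrow> 0) (at_right 0)"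
    proof -
      have "((\<lambda>h. poly (pCons 0 p) (inverse h) * exp (- inverse h)) \<longlongrightarrow> 0) (at_right (0::real))"
        using filterlim_compose[OF tendsto_poly_exp_neg filterlim_inverse_at_top_right] .
      moreover have "\<forall>\<^sub>F h in at_right 0. poly (pCons 0 p) (inverse h) * exp (- inverse h) = flat p h / h"
        by (auto simp: eventually_at_filter flat_def divide_inverse)
      ultimately show ?thesis by (rule Lim_transform_eventually)
    qed
    moreover have "((\<lambda>h. flat p h / h) \<longlongrightarrow> 0) (at_left 0)"
      by (rule tendsto_eventually) (auto simp: eventually_at_filter flat_def)
    ultimately have "((\<lambda>h. flat p h / h) \<longlongrightarrow> 0) (at 0)"
      by (simp add: filterlim_at_split)
    then show ?thesis using 2 by (simp add: DERIV_def flat_def)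
  next
    case 3
    have "((\<lambda>s. poly p (1 / s) * exp (- (1 / s))) has_real_derivative flat (flat_pderiv p) t) (at t)"
      using 3 by (auto intro!: derivative_eq_intros DERIV_chain2[OF poly_DERIV]
          simp: flat_def flat_pderiv_def poly_monom power2_eq_square field_simps)
    then show ?thesis
      by (rule has_field_derivative_transform_within_open[of _ _ _ "{0<..}"]) (use 3 in \<open>auto simp: flat_def\<close>)
  qed
qed

text \<open>A family of functions closed under partial derivatives: each member is then smooth without a formula
  for its iterated derivatives.\<close>
inductive_set flat_algebra :: "(real^4 \<Rightarrow> real) set" where
  base: "(\<lambda>x. flat p (a + s * x $ i)) \<in> flat_algebra"
| scale: "g \<in> flat_algebra \<Longrightarrow> (\<lambda>x. k * g x) \<in> flat_algebra"
| add: "\<lbrakk>g \<in> flat_algebra; h \<in> flat_algebra\<rbrakk> \<Longrightarrow> (\<lambda>x. g x + h x) \<in> flat_algebra"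
| mult: "\<lbrakk>g \<in> flat_algebra; h \<in> flat_algebra\<rbrakk> \<Longrightarrow> (\<lambda>x. g x * h x) \<in> flat_algebra"

lemma partial_deriv_eq:
  assumes "(u has_derivative u') (at x)"
  shows "partial_deriv j u x = u' (axis j 1)"
  unfolding partial_deriv_def using frechet_derivative_at[OF assms] by simp

lemma flat_algebra_deriv:
  assumes "g \<in> flat_algebra"
  shows "g differentiable (at x) \<and> partial_deriv j g \<in> flat_algebra"
  using assms
proof (induction arbitrary: x rule: flat_algebra.induct)
  case (base p a s i)
  have d: "((\<lambda>x. flat p (a + s * x $ i)) has_derivative
      (\<lambda>v. flat (flat_pderiv p) (a + s * x $ i) * (s * v $ i))) (at x)" for x :: "real^4"
  proof -
    have "((\<lambda>x::real^4. a + s * x $ i) has_derivative (\<lambda>v. s * v $ i)) (at x)"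
      by (auto intro!: derivative_eq_intros bounded_linear.has_derivative[OF bounded_linear_vec_nth])
    from has_derivative_compose[OF this DERIV_flat[unfolded has_field_derivative_def]]
    show ?thesis .
  qed
  have "partial_deriv j (\<lambda>x. flat p (a + s * x $ i))
      = (\<lambda>x. (s * (if i = j then 1 else 0)) * flat (flat_pderiv p) (a + s * x $ i))"
    using partial_deriv_eq[OF d] by (auto simp: fun_eq_iff axis_def)
  moreover have "\<dots> \<in> flat_algebra" by (intro flat_algebra.scale flat_algebra.base)
  ultimately show ?case using d by (auto simp: differentiable_def)
next
  case (scale g k)
  then have dg: "(g has_derivative frechet_derivative g (at x)) (at x)" for x
    by (auto simp: frechet_derivative_works)
  have "partial_deriv j (\<lambda>x. k * g x) = (\<lambda>x. k * partial_deriv j g x)"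
    using partial_deriv_eq[OF has_derivative_mult_right[OF dg]] by (auto simp: fun_eq_iff partial_deriv_def)
  then show ?case using scale flat_algebra.scale by auto
next
  case (add g h)
  then have dg: "(g has_derivative frechet_derivative g (at x)) (at x)"
    and dh: "(h has_derivative frechet_derivative h (at x)) (at x)" for x
    by (auto simp: frechet_derivative_works)
  have "partial_deriv j (\<lambda>x. g x + h x) = (\<lambda>x. partial_deriv j g x + partial_deriv j h x)"
    using partial_deriv_eq[OF has_derivative_add[OF dg dh]] by (auto simp: fun_eq_iff partial_deriv_def)
  then show ?case using add flat_algebra.add by auto
next
  case (mult g h)
  then have dg: "(g has_derivative frechet_derivative g (at x)) (at x)"
    and dh: "(h has_derivative frechet_derivative h (at x)) (at x)" for x
    by (auto simp: frechet_derivative_works)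
  have "partial_deriv j (\<lambda>x. g x * h x) = (\<lambda>x. g x * partial_deriv j h x + partial_deriv j g x * h x)"
    using partial_deriv_eq[OF has_derivative_mult[OF dg dh]] by (auto simp: fun_eq_iff partial_deriv_def)
  moreover have "\<dots> \<in> flat_algebra"
    using mult by (intro flat_algebra.add flat_algebra.mult) auto
  ultimately show ?case using mult by auto
qed

lemma flat_algebra_smooth:
  assumes "g \<in> flat_algebra"
  shows "smooth g"
proof -
  have "foldr partial_deriv js g \<in> flat_algebra" for js
    using assms flat_algebra_deriv by (induction js) auto
  then show ?thesis unfolding smooth_def using flat_algebra_deriv by blast
qed

lemma flat_algebra_continuous: "g \<in> flat_algebra \<Longrightarrow> continuous_on UNIV g"
  using flat_algebra_deriv by (intro differentiable_imp_continuous_on) (auto simp: differentiable_on_def)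

lemma flat_algebra_translate: "g \<in> flat_algebra \<Longrightarrow> (\<lambda>y. g (y - x)) \<in> flat_algebra"
proof (induction rule: flat_algebra.induct)
  case (base p a s i)
  have "(\<lambda>y. flat p (a + s * (y - x) $ i)) = (\<lambda>y. flat p ((a - s * x $ i) + s * y $ i))"
    by (simp add: algebra_simps)
  then show ?case using flat_algebra.base by simp
qed (auto intro: flat_algebra.intros)

lemma flat_algebra_deriv_along_line:
  assumes "g \<in> flat_algebra"
  shows "((\<lambda>t. g (y - (x + t *\<^sub>R v))) has_real_derivative
    - (\<Sum>j\<in>UNIV. v $ j * partial_deriv j g (y - (x + t *\<^sub>R v)))) (at t)"
proof -
  define z where "z = y - (x + t *\<^sub>R v)"
  define g' where "g' = frechet_derivative g (at z)"
  have g: "(g has_derivative g') (at z)"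
    using flat_algebra_deriv[OF assms] by (simp add: g'_def frechet_derivative_works)
  then have lin: "linear g'" by (rule has_derivative_linear)
  have "g' v = g' (\<Sum>j\<in>UNIV. v $ j *\<^sub>R axis j 1)" by (simp add: basis_expansion flip: scalar_mult_eq_scaleR)
  also have "\<dots> = (\<Sum>j\<in>UNIV. v $ j * partial_deriv j g z)"
    by (simp add: linear_sum[OF lin] linear_scale[OF lin] partial_deriv_def flip: g'_def)
  finally have v: "g' v = (\<Sum>j\<in>UNIV. v $ j * partial_deriv j g z)" .
  have "((\<lambda>t. y - (x + t *\<^sub>R v)) has_derivative (\<lambda>s. - (s *\<^sub>R v))) (at t)"
    by (auto intro!: derivative_eq_intros)
  from has_derivative_compose[OF this g[unfolded z_def]]
  show ?thesis
    unfolding has_field_derivative_def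
    by (rule has_derivative_eq_rhs) (simp add: fun_eq_iff linear_neg[OF lin] linear_scale[OF lin] v z_def)
qed

lemma partial_deriv_translate:
  assumes "g \<in> flat_algebra"
  shows "partial_deriv j (\<lambda>y. g (y - x)) y = partial_deriv j g (y - x)"
proof -
  have g: "(g has_derivative frechet_derivative g (at (y - x))) (at (y - x))"
    using flat_algebra_deriv[OF assms] by (simp add: frechet_derivative_works)
  have "((\<lambda>y. y - x) has_derivative (\<lambda>v. v)) (at y)" by (auto intro!: derivative_eq_intros)
  from partial_deriv_eq[OF has_derivative_compose[OF this g]] show ?thesis
    by (simp add: partial_deriv_def)
qed

lemma flat_algebra_partial_deriv_support:
  assumes "k \<in> flat_algebra" and supp: "\<And>z. \<rho> < norm z \<Longrightarrow> k z = 0" and z: "\<rho> < norm z"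
  shows "partial_deriv j k z = 0"
proof -
  have "open {z::real^4. \<rho> < norm z}" by (intro open_Collect_less continuous_intros)
  moreover have "((\<lambda>_. 0::real) has_derivative (\<lambda>_. 0)) (at z)" by simp
  ultimately have "(k has_derivative (\<lambda>_. 0)) (at z)"
    using has_derivative_transform_within_open[of "\<lambda>_. 0" "\<lambda>_. 0" z UNIV "{z. \<rho> < norm z}" k] z supp by auto
  from partial_deriv_eq[OF this] show ?thesis .
qed

lemma flat_one_pos_iff: "0 < flat 1 t \<longleftrightarrow> 0 < t" and flat_one_nonneg: "0 \<le> flat 1 t"
  by (auto simp: flat_def)

definition bump :: "real \<Rightarrow> real^4 \<Rightarrow> real" where
  "bump \<epsilon> z = (\<Prod>i\<in>UNIV. flat 1 (\<epsilon> + z $ i) * flat 1 (\<epsilon> - z $ i))"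

lemma bump_in_flat_algebra: "bump \<epsilon> \<in> flat_algebra"
proof -
  have b: "(\<lambda>z. flat 1 (\<epsilon> + z $ i) * flat 1 (\<epsilon> - z $ i)) \<in> flat_algebra" for i :: 4
    using flat_algebra.mult[OF flat_algebra.base[of 1 \<epsilon> 1 i] flat_algebra.base[of 1 \<epsilon> "-1" i]] by simp
  have "bump \<epsilon> = (\<lambda>z. (flat 1 (\<epsilon> + z $ 1) * flat 1 (\<epsilon> - z $ 1)) * ((flat 1 (\<epsilon> + z $ 2) * flat 1 (\<epsilon> - z $ 2))
      * ((flat 1 (\<epsilon> + z $ 3) * flat 1 (\<epsilon> - z $ 3)) * (flat 1 (\<epsilon> + z $ 4) * flat 1 (\<epsilon> - z $ 4)))))"
    unfolding bump_def UNIV_4 by (intro ext) simp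
  also have "\<dots> \<in> flat_algebra" by (intro flat_algebra.mult[OF b] b)
  finally show ?thesis .
qed

text \<open>The products over coordinates of \<open>flat 1 (\<epsilon> + z\<^sub>i) * flat 1 (\<epsilon> - z\<^sub>i)\<close> are supported in a cube; they
  have a positive integral, being continuous, nonnegative and positive at \<open>0\<close>.\<close>
lemma exists_smooth_kernel:
  assumes "0 < \<epsilon>"
  obtains k where "k \<in> flat_algebra" "\<And>z. 0 \<le> k z" "\<And>z. \<epsilon> < norm z \<Longrightarrow> k z = 0" "(\<integral>z. k z \<partial>lborel) = 1"
proof -
  define b where "b = bump (\<epsilon> / 4)"
  have b: "b \<in> flat_algebra" unfolding b_def by (rule bump_in_flat_algebra)
  have cont: "continuous_on UNIV b" by (rule flat_algebra_continuous[OF b])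
  have b0: "0 \<le> b z" for z unfolding b_def bump_def by (intro prod_nonneg) (simp add: flat_one_nonneg)
  have supp: "b z = 0" if "\<epsilon> < norm z" for z
  proof (rule ccontr)
    assume "b z \<noteq> 0"
    then have nz: "flat 1 (\<epsilon> / 4 + z $ i) \<noteq> 0" "flat 1 (\<epsilon> / 4 - z $ i) \<noteq> 0" for i
      unfolding b_def bump_def by auto
    have "\<bar>z $ i\<bar> \<le> \<epsilon> / 4" for i
      using nz[of i] unfolding flat_def by (simp split: if_splits)
    then have "(\<Sum>i\<in>UNIV. \<bar>z $ i\<bar>) \<le> (\<Sum>i\<in>(UNIV::4 set). \<epsilon> / 4)" by (intro sum_mono)
    then show False using norm_le_l1_cart[of z] that by simp
  qed
  have int: "integrable lborel b"
    using integrable_continuous_bounded_support[OF cont, of "cball 0 \<epsilon>"] supp by auto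
  have "(\<integral>z. b z \<partial>lborel) \<noteq> 0"
  proof
    assume "(\<integral>z. b z \<partial>lborel) = 0"
    then have "(b has_integral 0) UNIV" using has_integral_integral_lborel[OF int] by simp
    moreover have "b integrable_on cbox (- 1) 1" using cont continuous_on_subset integrable_continuous by blast
    then have I: "(b has_integral integral (cbox (- 1) 1) b) (cbox (- 1) 1)" by (rule integrable_integral)
    ultimately have "integral (cbox (- 1) 1) b \<le> 0"
      using has_integral_subset_le[OF _ I] b0 by blast
    then have "(b has_integral 0) (cbox (- 1) 1)"
      using I has_integral_nonneg[OF I b0] by simp
    then have "b 0 = 0"
      by (rule has_integral_0_cbox_imp_0[rotated 2])
        (use cont continuous_on_subset in \<open>auto simp: b0 mem_box_cart interval_ne_empty_cart\<close>)
    moreover have "0 < b 0" unfolding b_def bump_def using assms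
      by (intro prod_pos) (simp add: flat_one_pos_iff)
    ultimately show False by simp
  qed
  moreover have "0 \<le> (\<integral>z. b z \<partial>lborel)" by (simp add: b0)
  ultimately have Z: "0 < (\<integral>z. b z \<partial>lborel)" by simp
  show ?thesis
  proof (rule that[of "\<lambda>z. (1 / (\<integral>z. b z \<partial>lborel)) * b z"])
    show "(\<lambda>z. (1 / (\<integral>z. b z \<partial>lborel)) * b z) \<in> flat_algebra" by (rule flat_algebra.scale[OF b])
  qed (use Z b0 supp in auto)
qed

section \<open>Mollification of fields with a weak derivative\<close>

lemma integral_bounded_support_eq_cbox:
  fixes F :: "'a::euclidean_space \<Rightarrow> real"
  assumes "continuous_on UNIV F" "\<And>x. x \<notin> cbox a b \<Longrightarrow> F x = 0"
  shows "(\<integral>x. F x \<partial>lborel) = integral (cbox a b) F"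
proof -
  have "integrable lborel F"
    using assms by (intro integrable_continuous_bounded_support[where K = "cbox a b"]) auto
  then have "(\<integral>x. F x \<partial>lborel) = integral UNIV F" by (simp add: integral_lborel)
  also have "\<dots> = integral UNIV (\<lambda>x. if x \<in> cbox a b then F x else 0)"
    by (rule arg_cong[of _ _ "integral UNIV"]) (use assms(2) in auto)
  also have "\<dots> = integral (cbox a b) F" by (rule integral_restrict_UNIV)
  finally show ?thesis .
qed

text \<open>The derivative falls on the kernel, so that \<^term>\<open>f\<close> need only be continuous.\<close>
lemma convolution_deriv_along_line:
  fixes f :: "real^4 \<Rightarrow> real"
  assumes k: "k \<in> flat_algebra" and supp: "\<And>z. \<rho> < norm z \<Longrightarrow> k z = 0"
    and f: "continuous_on UNIV f"
  shows "((\<lambda>t. \<integral>y. k (y - (x + t *\<^sub>R v)) * f y \<partial>lborel) has_real_derivative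
     - (\<Sum>j\<in>UNIV. v $ j * (\<integral>y. partial_deriv j k (y - (x + t *\<^sub>R v)) * f y \<partial>lborel))) (at t)"
proof -
  define U where "U = {t - 1<..<t + 1}"
  define R where "R = \<rho> + norm x + (\<bar>t\<bar> + 1) * norm v"
  \<comment> \<open>A fixed box that contains the support of the kernel for all base points on the line with parameter near \<open>t\<close>.\<close>
  obtain a where box: "cball 0 R \<subseteq> cbox (- a) (a :: real^4)"
    using bounded_subset_cbox_symmetric[OF bounded_cball] by blast
  have far: "\<rho> < norm (y - (x + s *\<^sub>R v))" if "s \<in> U" "y \<notin> cbox (- a) a" for s y
  proof -
    have "R < norm y" using that box by (force simp: subset_iff)
    moreover have "norm y \<le> norm (y - (x + s *\<^sub>R v)) + (norm x + \<bar>s\<bar> * norm v)"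
      using norm_triangle_ineq[of "y - (x + s *\<^sub>R v)" "x + s *\<^sub>R v"] norm_triangle_ineq[of x "s *\<^sub>R v"] by simp
    moreover have "\<bar>s\<bar> * norm v \<le> (\<bar>t\<bar> + 1) * norm v"
      using that by (intro mult_right_mono) (auto simp: U_def)
    ultimately show ?thesis by (simp add: R_def)
  qed
  have pk: "partial_deriv j k \<in> flat_algebra" for j using flat_algebra_deriv[OF k] by blast
  have cont: "continuous_on UNIV (\<lambda>y. g (y - z) * f y)" if "g \<in> flat_algebra" for g z
    by (intro continuous_on_mult f continuous_on_compose2[OF flat_algebra_continuous[OF that]]) (auto intro!: continuous_intros)
  define fx where "fx s y = - (\<Sum>j\<in>UNIV. v $ j * partial_deriv j k (y - (x + s *\<^sub>R v))) * f y" for s y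
  have contfx: "continuous_on UNIV (\<lambda>(s, y). fx s y)"
  proof -
    have "continuous_on UNIV (\<lambda>q::real \<times> (real^4). snd q - (x + fst q *\<^sub>R v))"
      by (intro continuous_intros)
    then have "continuous_on UNIV (\<lambda>q. partial_deriv j k (snd q - (x + fst q *\<^sub>R v)))" for j
      using continuous_on_compose2[OF flat_algebra_continuous[OF pk]] by blast
    moreover have "continuous_on UNIV (\<lambda>q::real \<times> (real^4). f (snd q))"
      by (rule continuous_on_compose2[OF f]) (auto intro: continuous_intros)
    ultimately show ?thesis
      unfolding fx_def split_beta
      by (intro continuous_on_mult continuous_on_minus continuous_on_sum continuous_on_const)
  qed
  have "((\<lambda>s. integral (cbox (- a) a) (\<lambda>y. k (y - (x + s *\<^sub>R v)) * f y)) has_real_derivative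
      integral (cbox (- a) a) (fx t)) (at t within U)"
  proof (rule leibniz_rule_field_derivative)
    show "((\<lambda>s. k (y - (x + s *\<^sub>R v)) * f y) has_real_derivative fx s y) (at s within U)" for s y
      unfolding fx_def
      by (rule has_field_derivative_at_within, rule DERIV_cmult_right, rule flat_algebra_deriv_along_line[OF k])
    show "(\<lambda>y. k (y - (x + s *\<^sub>R v)) * f y) integrable_on cbox (- a) a" for s
      using cont[OF k] continuous_on_subset integrable_continuous by blast
    show "continuous_on (U \<times> cbox (- a) a) (\<lambda>(s, y). fx s y)"
      using contfx continuous_on_subset by blast
  qed (auto simp: U_def)
  moreover have "at t within U = at t" by (rule at_within_open) (auto simp: U_def)
  ultimately have d: "((\<lambda>s. integral (cbox (- a) a) (\<lambda>y. k (y - (x + s *\<^sub>R v)) * f y)) has_real_derivative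
      integral (cbox (- a) a) (fx t)) (at t)" by simp
  have int: "integrable lborel (\<lambda>y. partial_deriv j k (y - (x + t *\<^sub>R v)) * f y)" for j
    using far[of t] flat_algebra_partial_deriv_support[OF k supp]
    by (intro integrable_continuous_bounded_support[OF cont[OF pk], where K = "cbox (- a) a"]) (auto simp: U_def)
  have "integral (cbox (- a) a) (fx t) = (\<integral>y. fx t y \<partial>lborel)"
  proof (rule integral_bounded_support_eq_cbox[symmetric])
    show "continuous_on UNIV (fx t)"
      unfolding fx_def
      by (intro continuous_on_mult continuous_on_minus continuous_on_sum continuous_on_const
          f continuous_on_compose2[OF flat_algebra_continuous[OF pk]])
        (auto intro!: continuous_intros)
    show "fx t y = 0" if "y \<notin> cbox (- a) a" for y
      using far[OF _ that, of t] flat_algebra_partial_deriv_support[OF k supp] by (simp add: fx_def U_def)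
  qed
  also have "\<dots> = (\<integral>y. - (\<Sum>j\<in>UNIV. v $ j * (partial_deriv j k (y - (x + t *\<^sub>R v)) * f y)) \<partial>lborel)"
    by (simp add: fx_def sum_distrib_right mult.assoc)
  also have "\<dots> = - (\<Sum>j\<in>UNIV. v $ j * (\<integral>y. partial_deriv j k (y - (x + t *\<^sub>R v)) * f y \<partial>lborel))"
    using int by (simp add: Bochner_Integration.integral_sum)
  finally have eq: "integral (cbox (- a) a) (fx t) = \<dots>" .
  show ?thesis
  proof (rule has_field_derivative_transform_within_open[OF d[unfolded eq], of U])
    show "integral (cbox (- a) a) (\<lambda>y. k (y - (x + s *\<^sub>R v)) * f y) = (\<integral>y. k (y - (x + s *\<^sub>R v)) * f y \<partial>lborel)"
      if "s \<in> U" for s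
      using far[OF that] supp by (intro integral_bounded_support_eq_cbox[symmetric] cont k) auto
  qed (auto simp: U_def)
qed

lemma convolution_continuous:
  fixes f :: "real^4 \<Rightarrow> real"
  assumes g: "g \<in> flat_algebra" and supp: "\<And>z. \<rho> < norm z \<Longrightarrow> g z = 0"
    and f: "continuous_on UNIV f"
  shows "continuous_on UNIV (\<lambda>x. \<integral>y. g (y - x) * f y \<partial>lborel)"
proof -
  obtain a where box: "cball 0 \<rho> \<subseteq> cbox (- a) (a :: real^4)"
    using bounded_subset_cbox_symmetric[OF bounded_cball] by blast
  have cg: "continuous_on UNIV g" by (rule flat_algebra_continuous[OF g])
  have m: "(\<lambda>y. g (y - x) * f y) \<in> borel_measurable borel" for x
    by (intro borel_measurable_continuous_onI continuous_on_mult f continuous_on_compose2[OF cg])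
      (auto intro!: continuous_intros)
  have "(\<integral>y. g (y - x) * f y \<partial>lborel) = integral (cbox (- a) a) (\<lambda>z. g z * f (z + x))" for x
  proof -
    have "(\<integral>y. g (y - x) * f y \<partial>lborel) = (\<integral>z. g z * f (z + x) \<partial>lborel)"
      using integral_shift_lborel[OF m, of x x] by simp
    also have "\<dots> = integral (cbox (- a) a) (\<lambda>z. g z * f (z + x))"
      using box supp
      by (intro integral_bounded_support_eq_cbox continuous_on_mult cg continuous_on_compose2[OF f])
        (force intro!: continuous_intros simp: subset_iff)+
    finally show ?thesis .
  qed
  moreover have "continuous_on UNIV (\<lambda>x. integral (cbox (- a) a) (\<lambda>z. g z * f (z + x)))"
    unfolding split_beta
    by (intro integral_continuous_on_param)
      (auto simp: split_beta intro!: continuous_intros continuous_on_compose2[OF f] continuous_on_compose2[OF cg])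
  ultimately show ?thesis by simp
qed

lemma Basis_cart_image: "(Basis :: (real^'n) set) = range (\<lambda>i. axis i 1)"
  by (auto simp: Basis_vec_def)

lemma trace_of_matrix: "trace_of (\<lambda>v. M *v v) = trace (M :: real^'n^'n)"
proof -
  have "trace_of (\<lambda>v. M *v v) = (\<Sum>i\<in>UNIV. (M *v axis i 1) \<bullet> axis i 1)"
    unfolding trace_of_def Basis_cart_image
    by (subst sum.reindex) (auto simp: inj_on_def axis_eq_axis)
  then show ?thesis by (simp add: trace_def inner_axis matrix_vector_mul_component)
qed

lemma has_vector_derivative_cart:
  fixes F :: "real \<Rightarrow> real^'n"
  assumes "\<And>i. ((\<lambda>t. F t $ i) has_real_derivative D $ i) (at t)"
  shows "(F has_vector_derivative D) (at t)"
proof -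
  have "((\<lambda>t. F t $ i) has_derivative (\<lambda>h. h * D $ i)) (at t)" for i
    using assms[of i] by (simp add: has_field_derivative_def mult_commute_abs)
  then show ?thesis
    unfolding has_vector_derivative_def has_derivative_componentwise_within[of F] Basis_cart_image
    by (simp add: inner_axis)
qed

text \<open>Local integrability suffices because a continuous kernel is bounded on the ball outside of which it
  vanishes.\<close>
lemma integrable_kernel_weak_derivative:
  fixes Df :: "real^4 \<Rightarrow> real^4^4"
  assumes Df: "Lp_loc 1 Df" and k: "continuous_on UNIV k" "\<And>z. \<rho> < norm z \<Longrightarrow> k z = 0"
  shows "integrable lebesgue (\<lambda>y. k (y - x) *\<^sub>R Df y)"
proof -
  have [measurable]: "Df \<in> borel_measurable lebesgue" using Df by (simp add: Lp_loc_def)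
  have ck: "continuous_on UNIV (\<lambda>y. k (y - x))"
    by (rule continuous_on_compose2[OF k(1)]) (auto intro!: continuous_intros)
  then have "(\<lambda>y. k (y - x)) \<in> borel_measurable borel" by (rule borel_measurable_continuous_onI)
  then have [measurable]: "(\<lambda>y. k (y - x)) \<in> borel_measurable lebesgue"
    by (simp add: measurable_completion)
  define K where "K = cball x \<rho>"
  have "compact ((\<lambda>y. k (y - x)) ` K)"
    unfolding K_def by (intro compact_continuous_image continuous_on_subset[OF ck]) auto
  then have "bounded ((\<lambda>y. k (y - x)) ` K)" by (rule compact_imp_bounded)
  then obtain B where B: "\<And>y. y \<in> K \<Longrightarrow> \<bar>k (y - x)\<bar> \<le> B"
    unfolding bounded_iff by auto
  have "set_integrable lebesgue K (\<lambda>y. norm (Df y) powr 1)"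
    using Df by (simp add: Lp_loc_def K_def)
  then have "integrable lebesgue (\<lambda>y. B * (indicator K y * (norm (Df y) powr 1)))"
    unfolding set_integrable_def by simp
  then show ?thesis
  proof (rule Bochner_Integration.integrable_bound)
    have "norm (k (y - x) *\<^sub>R Df y) \<le> norm (B * (indicator K y * (norm (Df y) powr 1)))" for y
    proof (cases "y \<in> K")
      case True
      then have "norm (k (y - x) *\<^sub>R Df y) \<le> B * norm (Df y)" using B by (simp add: mult_right_mono)
      also have "\<dots> \<le> \<bar>B * norm (Df y)\<bar>" by simp
      finally show ?thesis using True by simp
    next
      case False
      then have "k (y - x) = 0" by (intro k(2)) (simp add: K_def dist_norm norm_minus_commute)
      then show ?thesis by simp
    qed
    then show "AE y in lebesgue. norm (k (y - x) *\<^sub>R Df y) \<le> norm (B * (indicator K y * (norm (Df y) powr 1)))"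
      by simp
  qed measurable
qed

text \<open>The derivative of the mollified field is the mollification of the weak derivative, which is the
  definition of the weak derivative with a translated kernel as the test function. Hence every linear
  functional that is nonnegative on almost all values of the weak derivative is nonnegative on the new
  derivative, and the conditions defining pinched fields are of this kind.\<close>
lemma mollified_pinched:
  fixes f :: "real^4 \<Rightarrow> real^4"
  assumes f: "continuous_on UNIV f" and weak: "has_weak_derivative f Df"
    and lower: "AE y in lebesgue. \<forall>v. c * trace (Df y) * (norm v)\<^sup>2 \<le> (Df y *v v) \<bullet> v"
    and nonneg: "AE y in lebesgue. \<forall>v. 0 \<le> (Df y *v v) \<bullet> v"
    and k: "k \<in> flat_algebra" "\<And>z. 0 \<le> k z" "\<And>z. \<rho> < norm z \<Longrightarrow> k z = 0"
  shows "\<exists>A. pinched c (\<lambda>x. \<chi> i. \<integral>y. k (y - x) * f y $ i \<partial>lborel) A"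
proof -
  define F where "F x = (\<chi> i. \<integral>y. k (y - x) * f y $ i \<partial>lborel)" for x
  define M where "M x = (\<integral>y. k (y - x) *\<^sub>R Df y \<partial>lebesgue)" for x
  have Df: "Lp_loc 1 Df" using weak by (simp add: has_weak_derivative_def)
  have ck: "continuous_on UNIV k" by (rule flat_algebra_continuous[OF k(1)])
  have fi: "continuous_on UNIV (\<lambda>y. f y $ i)" for i by (intro continuous_intros f)
  have int: "integrable lebesgue (\<lambda>y. k (y - x) *\<^sub>R Df y)" for x
    by (rule integrable_kernel_weak_derivative[OF Df ck k(3)])
  have functional: "\<Lambda> (M x) = (\<integral>y. k (y - x) * \<Lambda> (Df y) \<partial>lebesgue)" if "bounded_linear \<Lambda>" for \<Lambda> :: "real^4^4 \<Rightarrow> real" and x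
    unfolding M_def using integral_bounded_linear[OF that int]
    by (simp add: bounded_linear.linear[OF that] linear_scale)
  have Mij: "M x $ i $ j = - (\<integral>y. partial_deriv j k (y - x) * f y $ i \<partial>lborel)" for x i j
  proof -
    have "test_function (\<lambda>y. k (y - x))"
      unfolding test_function_def
    proof
      show "smooth (\<lambda>y. k (y - x))" by (intro flat_algebra_smooth flat_algebra_translate k)
      have "{y. k (y - x) \<noteq> 0} \<subseteq> cball x \<rho>"
        using k(3) by (force simp: dist_norm norm_minus_commute)
      then have "bounded {y. k (y - x) \<noteq> 0}" by (rule bounded_subset[OF bounded_cball])
      then show "compact (closure {y. k (y - x) \<noteq> 0})" by simp
    qed
    then have "(\<integral>y. f y $ i * partial_deriv j (\<lambda>y. k (y - x)) y \<partial>lebesgue) = - (\<integral>y. Df y $ i $ j * k (y - x) \<partial>lebesgue)"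
      using weak unfolding has_weak_derivative_def by blast
    moreover have "(\<integral>y. f y $ i * partial_deriv j (\<lambda>y. k (y - x)) y \<partial>lebesgue)
        = (\<integral>y. partial_deriv j k (y - x) * f y $ i \<partial>lborel)"
    proof -
      have "continuous_on UNIV (partial_deriv j k)"
        using flat_algebra_continuous flat_algebra_deriv[OF k(1)] by blast
      then have "continuous_on UNIV (\<lambda>y. partial_deriv j k (y - x))"
        by (rule continuous_on_compose2) (auto intro!: continuous_intros)
      then have "(\<lambda>y. f y $ i * partial_deriv j k (y - x)) \<in> borel_measurable borel"
        by (intro borel_measurable_continuous_onI continuous_on_mult fi)
      then show ?thesis
        by (simp add: partial_deriv_translate[OF k(1)] integral_completion mult.commute)
    qed
    moreover have "M x $ i $ j = (\<integral>y. k (y - x) * Df y $ i $ j \<partial>lebesgue)"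
      by (rule functional) (intro bounded_linear_compose[OF bounded_linear_vec_nth bounded_linear_vec_nth])
    ultimately show ?thesis by (simp add: mult.commute)
  qed
  have contM: "continuous_on UNIV (\<lambda>x. M x $ i $ j)" for i j
    unfolding Mij using flat_algebra_deriv[OF k(1)]
    by (intro continuous_on_minus convolution_continuous[where \<rho> = \<rho>] fi
        flat_algebra_partial_deriv_support[OF k(1) k(3)]) auto
  have "pinched c F (\<lambda>x v. M x *v v)"
    unfolding pinched_def
  proof (intro conjI allI)
    show "((\<lambda>t. F (x + t *\<^sub>R v)) has_vector_derivative M (x + t *\<^sub>R v) *v v) (at t)" for x v t
    proof (rule has_vector_derivative_cart)
      fix i
      show "((\<lambda>t. F (x + t *\<^sub>R v) $ i) has_real_derivative (M (x + t *\<^sub>R v) *v v) $ i) (at t)"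
        using convolution_deriv_along_line[OF k(1) k(3) fi[of i], where x = x and v = v and t = t]
        by (simp add: F_def matrix_vector_mult_def Mij sum_negf mult.commute)
    qed
    show "continuous_on UNIV F"
      unfolding F_def by (intro continuous_on_vec_lambda convolution_continuous[OF k(1) k(3) fi])
    show "continuous_on UNIV (\<lambda>x. M x *v v)" for v
      unfolding matrix_vector_mult_def
      by (intro continuous_on_vec_lambda continuous_on_sum continuous_on_mult contM continuous_on_const)
    show "linear (\<lambda>v. M x *v v)" for x by simp
    have pos: "0 \<le> \<Lambda> (M x)" if "linear \<Lambda>" "AE y in lebesgue. 0 \<le> \<Lambda> (Df y)" for \<Lambda> :: "real^4^4 \<Rightarrow> real" and x
    proof -
      have "0 \<le> (\<integral>y. k (y - x) * \<Lambda> (Df y) \<partial>lebesgue)"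
        by (rule integral_nonneg_AE) (use that(2) k(2) in \<open>auto elim!: eventually_mono\<close>)
      then show ?thesis using functional that(1) by (simp add: linear_conv_bounded_linear)
    qed
    show "0 \<le> (M x *v v) \<bullet> v" for x v
      by (rule pos) (use nonneg in \<open>auto elim!: eventually_mono intro!: linearI
          simp: matrix_vector_mult_add_rdistrib inner_add_left simp flip: scaleR_matrix_vector_assoc\<close>)
    have "0 \<le> (M x *v v) \<bullet> v - c * (norm v)\<^sup>2 * trace (M x)" for x v
    proof (rule pos)
      show "linear (\<lambda>A :: real^4^4. (A *v v) \<bullet> v - c * (norm v)\<^sup>2 * trace A)"
        by (rule linearI) (simp_all add: matrix_vector_mult_add_rdistrib inner_add_left trace_def sum.distrib
            sum_distrib_left algebra_simps flip: scaleR_matrix_vector_assoc)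
      show "AE y in lebesgue. 0 \<le> (Df y *v v) \<bullet> v - c * (norm v)\<^sup>2 * trace (Df y)"
        using lower by (rule eventually_mono) (simp add: mult_ac)
    qed
    then show "c * trace_of (\<lambda>v. M x *v v) * (norm v)\<^sup>2 \<le> (M x *v v) \<bullet> v" for x v
      by (simp add: trace_of_matrix mult_ac)
  qed
  then show ?thesis unfolding F_def by blast
qed

lemma kernel_average_close:
  fixes g :: "real^4 \<Rightarrow> real"
  assumes k: "continuous_on UNIV k" "\<And>z. 0 \<le> k z" "\<And>z. \<rho> < norm z \<Longrightarrow> k z = 0" "(\<integral>z. k z \<partial>lborel) = 1"
    and g: "continuous_on UNIV g" "\<And>y. norm (y - x) \<le> \<rho> \<Longrightarrow> \<bar>g y - g x\<bar> \<le> \<eta>"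
  shows "\<bar>(\<integral>y. k (y - x) * g y \<partial>lborel) - g x\<bar> \<le> \<eta>"
proof -
  have ck: "continuous_on UNIV (\<lambda>y. k (y - x))"
    by (rule continuous_on_compose2[OF k(1)]) (auto intro!: continuous_intros)
  have int: "integrable lborel (\<lambda>y. k (y - x) * h y)" if "continuous_on UNIV h" for h :: "real^4 \<Rightarrow> real"
    using k(3) by (intro integrable_continuous_bounded_support[OF continuous_on_mult[OF ck that], of "cball x \<rho>"])
      (auto simp: dist_norm norm_minus_commute)
  have one: "(\<integral>y. k (y - x) \<partial>lborel) = 1"
    using integral_shift_lborel[of k "- x"] borel_measurable_continuous_onI[OF k(1)] k(4) by simp
  have i1: "integrable lborel (\<lambda>y. k (y - x))" using int[of "\<lambda>_. 1"] by simp
  have "(\<integral>y. k (y - x) * g y \<partial>lborel) - g x = (\<integral>y. k (y - x) * g y - k (y - x) * g x \<partial>lborel)"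
    using int[OF g(1)] i1 one by simp
  also have "\<bar>\<dots>\<bar> \<le> (\<integral>y. k (y - x) * \<eta> \<partial>lborel)"
  proof (rule integral_abs_bound_integral)
    show "\<bar>k (y - x) * g y - k (y - x) * g x\<bar> \<le> k (y - x) * \<eta>" for y
    proof (cases "norm (y - x) \<le> \<rho>")
      case True
      have "k (y - x) * g y - k (y - x) * g x = k (y - x) * (g y - g x)" by (simp add: right_diff_distrib)
      then show ?thesis using g(2)[OF True] k(2)[of "y - x"] by (simp add: abs_mult mult_left_mono)
    qed (simp add: k(3))
  qed (use int[OF g(1)] i1 in auto)
  also have "\<dots> = \<eta>" using one by simp
  finally show ?thesis .
qed

lemma pinched_approximation:
  fixes f :: "real^4 \<Rightarrow> real^4"
  assumes f: "continuous_on UNIV f" and weak: "has_weak_derivative f Df"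
    and lower: "AE y in lebesgue. \<forall>v. c * trace (Df y) * (norm v)\<^sup>2 \<le> (Df y *v v) \<bullet> v"
    and nonneg: "AE y in lebesgue. \<forall>v. 0 \<le> (Df y *v v) \<bullet> v"
  obtains F A where "\<And>n::nat. pinched c (F n) (A n)" "\<And>x. (\<lambda>n. F n x) \<longlonglongrightarrow> f x"
proof -
  have "\<exists>k. k \<in> flat_algebra \<and> (\<forall>z. 0 \<le> k z) \<and> (\<forall>z. 1 / Suc n < norm z \<longrightarrow> k z = 0) \<and> (\<integral>z. k z \<partial>lborel) = 1" for n :: nat
    using exists_smooth_kernel[of "1 / Suc n"] by (metis of_nat_0_less_iff zero_less_Suc zero_less_divide_1_iff)
  then obtain k where k: "k n \<in> flat_algebra" "0 \<le> k n z" "1 / Suc n < norm z \<Longrightarrow> k n z = 0" "(\<integral>z. k n z \<partial>lborel) = 1" for n z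
    by metis
  define F where "F n x = (\<chi> i. \<integral>y. k n (y - x) * f y $ i \<partial>lborel)" for n x
  have "\<exists>A. pinched c (F n) A" for n
    unfolding F_def using mollified_pinched[OF f weak lower nonneg k(1,2,3)] .
  then obtain A where A: "pinched c (F n) (A n)" for n by metis
  have "(\<lambda>n. F n x) \<longlonglongrightarrow> f x" for x
  proof (rule vec_tendstoI, rule LIMSEQ_I)
    fix i and r :: real
    assume "0 < r"
    have fi: "continuous_on UNIV (\<lambda>y. f y $ i)" by (intro continuous_intros f)
    obtain d where d: "0 < d" "\<And>y. norm (y - x) < d \<Longrightarrow> \<bar>f y $ i - f x $ i\<bar> < r / 2"
      using fi \<open>0 < r\<close> unfolding continuous_on_iff by (metis UNIV_I dist_norm half_gt_zero real_norm_def)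
    obtain n0 where n0: "1 / real (Suc n0) < d" using d(1) nat_approx_posE by blast
    show "\<exists>n0. \<forall>n\<ge>n0. norm (F n x $ i - f x $ i) < r"
    proof (intro exI allI impI)
      fix n assume "n0 \<le> n"
      then have "1 / real (Suc n) \<le> 1 / real (Suc n0)" by (simp add: frac_le)
      with n0 have "1 / real (Suc n) < d" by simp
      then have "\<bar>(\<integral>y. k n (y - x) * f y $ i \<partial>lborel) - f x $ i\<bar> \<le> r / 2"
        using d(2) by (intro kernel_average_close[where \<rho> = "1 / real (Suc n)"] flat_algebra_continuous k fi)
          (auto intro: less_imp_le)
      then show "norm (F n x $ i - f x $ i) < r" using \<open>0 < r\<close> by (simp add: F_def)
    qed
  qed
  with A show ?thesis using that by blast
qed

section \<open>Quaternions and the matrix cone\<close>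

text \<open>If the quadratic form is small at \<open>v\<close>, then so is \<open>B v\<close>. Move from \<open>v\<close> a distance \<open>\<delta> / 4\<close> in the
  direction \<open>\<plusminus>w\<close>, with the sign for which \<open>B w \<bullet> v\<close> does not increase the form. Up to a multiple of
  its value at \<open>v\<close>, the form then grows only by a quadratic term \<open>(\<delta>\<^sup>2 / 16) b\<close>, while the norm of the image grows linearly, so the cone
  condition forces at least \<open>(3 \<delta>\<^sup>2 / 16) b\<close>; this bounds \<open>b = B w \<bullet> w\<close>.\<close>
lemma matrix_cone_quadratic_form_comparable:
  assumes B: "B \<in> matrix_cone \<delta>" and d: "0 < \<delta>" "\<delta> \<le> 1" and v: "norm v = 1" and w: "norm w = 1"
  shows "\<delta>\<^sup>2 / 24 * ((B *v w) \<bullet> w) \<le> (B *v v) \<bullet> v"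
proof -
  define a b where "a = (B *v v) \<bullet> v" and "b = (B *v w) \<bullet> w"
  define s where "s = (if (B *v w) \<bullet> v \<le> 0 then \<delta> / 4 else - \<delta> / 4)"
  have cone: "\<delta> * norm (B *v x) * norm x \<le> (B *v x) \<bullet> x" for x
    using B by (simp add: matrix_cone_def)
  have Bv: "\<delta> * norm (B *v v) \<le> a" using cone[of v] v by (simp add: a_def)
  have Bw: "b \<le> norm (B *v w)"
    using norm_cauchy_schwarz[of "B *v w" w] w by (simp add: b_def)
  have a0: "0 \<le> a" using Bv d by (meson mult_nonneg_nonneg norm_ge_zero order_trans less_imp_le)
  have b0: "0 \<le> b" using cone[of w] d by (simp add: b_def) (meson mult_nonneg_nonneg norm_ge_zero order_trans less_imp_le)
  have s: "\<bar>s\<bar> = \<delta> / 4" "s * ((B *v w) \<bullet> v) \<le> 0" using d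
    by (auto simp: s_def mult_nonneg_nonpos)
  \<comment> \<open>The test vector at distance \<open>\<delta> / 4\<close> from \<open>v\<close> towards \<open>w\<close> or \<open>- w\<close>.\<close>
  define x where "x = v + s *\<^sub>R w"
  have Bx: "B *v x = B *v v + s *\<^sub>R (B *v w)"
    by (simp add: x_def matrix_vector_right_distrib matrix_vector_mult_scaleR)
  have "(B *v x) \<bullet> x = a + s * ((B *v v) \<bullet> w) + s * ((B *v w) \<bullet> v) + s\<^sup>2 * b"
    unfolding Bx by (simp add: x_def a_def b_def inner_add power2_eq_square algebra_simps)
  also have "\<dots> \<le> a + a / 4 + 0 + s\<^sup>2 * b"
  proof -
    have "s * ((B *v v) \<bullet> w) \<le> \<bar>s\<bar> * \<bar>(B *v v) \<bullet> w\<bar>" by (metis abs_ge_self abs_mult)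
    also have "\<dots> \<le> \<delta> / 4 * norm (B *v v)"
      using Cauchy_Schwarz_ineq2[of "B *v v" w] w d s by (intro mult_mono) auto
    finally show ?thesis using Bv s by simp
  qed
  also have "s\<^sup>2 = \<delta>\<^sup>2 / 16" by (simp add: s_def power2_eq_square)
  finally have up: "(B *v x) \<bullet> x \<le> a + a / 4 + \<delta>\<^sup>2 / 16 * b" by simp
  have nx: "3/4 \<le> norm x"
    using norm_triangle_ineq2[of v "- (s *\<^sub>R w)"] v w s d by (simp add: x_def)
  have nBx: "\<delta> / 4 * b - norm (B *v v) \<le> norm (B *v x)"
  proof -
    have "norm (s *\<^sub>R (B *v w)) \<le> norm (B *v x) + norm (B *v v)"
      unfolding Bx by (metis add_diff_cancel_left' norm_triangle_ineq4)
    moreover have "\<delta> / 4 * b \<le> norm (s *\<^sub>R (B *v w))"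
      using mult_left_mono[OF Bw, of "\<delta> / 4"] d unfolding norm_scaleR s(1) by simp
    ultimately show ?thesis by simp
  qed
  have "\<delta> * (\<delta> / 4 * b - norm (B *v v)) * (3/4) \<le> \<delta> * norm (B *v x) * (3/4)"
    using nBx d by (intro mult_left_mono mult_right_mono) auto
  also have "\<dots> \<le> \<delta> * norm (B *v x) * norm x" using nx d by (intro mult_left_mono) auto
  also have "\<dots> \<le> (B *v x) \<bullet> x" by (rule cone)
  finally have "3/16 * (\<delta>\<^sup>2 * b) - 3/4 * (\<delta> * norm (B *v v)) \<le> (B *v x) \<bullet> x"
    by (simp add: power2_eq_square algebra_simps)
  with up Bv a0 show ?thesis by (simp add: a_def[symmetric] b_def[symmetric] field_simps)
qed

text \<open>Imaginary quaternions are skew-symmetric matrices.\<close>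
lemma quat_Im_inner: "Q \<in> quaternions \<Longrightarrow> (quat_Im Q *v v) \<bullet> v = 0"
  unfolding quaternions_def quat_Im_def
  by (auto simp: quat_Re_def quat_def matrix_vector_mult_def inner_vec_def sum_4 mat_def algebra_simps)

lemma quat_proj_in: "quat_proj A \<in> quaternions"
  unfolding quat_proj_def using theI'[OF quat_proj_well_defined[of A]] by blast

text \<open>Subtracting the imaginary part does not change the quadratic form, and the trace is the sum of the
  four values of the form at the coordinate vectors.\<close>
lemma reduced_cone_quadratic_form_bounds:
  assumes A: "A - quat_Im (quat_proj A) \<in> matrix_cone \<delta>" and d: "0 < \<delta>" "\<delta> \<le> 1"
  shows "\<delta>\<^sup>2 / 96 * trace A * (norm v)\<^sup>2 \<le> (A *v v) \<bullet> v" "0 \<le> (A *v v) \<bullet> v"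
proof -
  have eq: "(A *v v) \<bullet> v = ((A - quat_Im (quat_proj A)) *v v) \<bullet> v" for v
    by (simp add: matrix_vector_mult_diff_rdistrib inner_diff_left quat_Im_inner[OF quat_proj_in])
  have "\<delta> * norm ((A - quat_Im (quat_proj A)) *v v) * norm v \<le> (A *v v) \<bullet> v"
    unfolding eq using A by (simp add: matrix_cone_def)
  then show "0 \<le> (A *v v) \<bullet> v" using d
    by (meson mult_nonneg_nonneg norm_ge_zero order_trans less_imp_le)
  show "\<delta>\<^sup>2 / 96 * trace A * (norm v)\<^sup>2 \<le> (A *v v) \<bullet> v"
  proof (cases "v = 0")
    case False
    define u where "u = (1 / norm v) *\<^sub>R v"
    have u: "norm u = 1" "v = norm v *\<^sub>R u" using False by (simp_all add: u_def)
    have "\<delta>\<^sup>2 / 24 * ((A *v axis i 1) \<bullet> axis i 1) \<le> (A *v u) \<bullet> u" for i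
      using matrix_cone_quadratic_form_comparable[OF A d u(1), of "axis i 1"] by (simp add: eq norm_axis_1)
    then have "\<delta>\<^sup>2 / 24 * (A $ i $ i) \<le> (A *v u) \<bullet> u" for i
      by (simp add: inner_axis matrix_vector_mul_component inner_axis)
    then have "(\<Sum>i\<in>UNIV. \<delta>\<^sup>2 / 24 * (A $ i $ i)) \<le> (\<Sum>i\<in>(UNIV::4 set). (A *v u) \<bullet> u)"
      by (intro sum_mono)
    moreover have "(\<Sum>i\<in>UNIV. \<delta>\<^sup>2 / 24 * (A $ i $ i)) = \<delta>\<^sup>2 / 24 * trace A"
      by (simp only: trace_def sum_distrib_left)
    ultimately have "\<delta>\<^sup>2 / 96 * trace A \<le> (A *v u) \<bullet> u"
      by simp
    then have "\<delta>\<^sup>2 / 96 * trace A * (norm v)\<^sup>2 \<le> (A *v u) \<bullet> u * (norm v)\<^sup>2"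
      by (rule mult_right_mono) simp
    also have "\<dots> = (A *v v) \<bullet> v"
      using False by (simp add: u_def matrix_vector_mult_scaleR power2_eq_square)
    finally show ?thesis .
  qed simp
qed

section \<open>Logarithmic growth of increments and the gauge\<close>

text \<open>Cutting the index interval so that each part contains at most half of the selected increments costs
  one increment of \<^term>\<open>m\<close> per generation of cuts, because the increments of \<^term>\<open>m\<close> on the parts add up. A single selected
  increment is isolated by two more cuts.\<close>
lemma sum_increments_le_log_card:
  fixes F :: "nat \<Rightarrow> 'a::real_normed_vector" and m :: "nat \<Rightarrow> real"
  assumes kink: "\<And>i u j. i \<le> u \<Longrightarrow> u \<le> j \<Longrightarrow> j \<le> N \<Longrightarrow>
      norm (F u - F i) + norm (F j - F u) \<le> norm (F j - F i) + (m j - m i)"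
  shows "\<lbrakk>a \<le> b; b \<le> N; J \<subseteq> {a<..b}; card J \<le> 2 ^ k\<rbrakk> \<Longrightarrow>
    (\<Sum>j\<in>J. norm (F j - F (j - 1))) \<le> norm (F b - F a) + (real k + 2) * (m b - m a)"
proof (induction k arbitrary: a b J)
  case 0
  have mono: "m i \<le> m j" if "i \<le> j" "j \<le> N" for i j
    using kink[of i i j] that by simp
  show ?case
  proof (cases "J = {}")
    case True
    then show ?thesis using mono[of a b] 0 by simp
  next
    case False
    have "finite J" using 0(3) finite_subset by blast
    with False 0(4) have "card J = 1"
      by (simp add: Suc_leI card_gt_0_iff le_antisym)
    then obtain j where J: "J = {j}" by (auto simp: card_1_singleton_iff)
    with 0 have j: "a < j" "j \<le> b" by auto
    have "norm (F j - F a) \<le> norm (F b - F a) + (m b - m a)"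
      using kink[of a j b] j 0 by (smt (verit) norm_ge_zero less_imp_le)
    moreover have "norm (F j - F (j - 1)) \<le> norm (F j - F a) + (m j - m a)"
      using kink[of a "j - 1" j] j 0 by (smt (verit) norm_ge_zero Suc_pred' diff_le_self less_Suc_eq_le le_trans not_less_zero gr0I)
    moreover have "m j \<le> m b" using mono j 0 by blast
    ultimately show ?thesis by (simp add: J)
  qed
next
  case (Suc k)
  have mono: "m i \<le> m j" if "i \<le> j" "j \<le> N" for i j
    using kink[of i i j] that by simp
  define P where "P p \<longleftrightarrow> a \<le> p \<and> p \<le> b \<and> card (J \<inter> {..p}) \<le> 2 ^ k" for p
  have fin: "finite J" using Suc.prems(3) finite_subset by blast
  have "J \<inter> {..a} = {}" using Suc.prems(3) by auto
  then have "card (J \<inter> {..a}) \<le> 2 ^ k" by (simp only: card.empty)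
  then have "P a" using Suc.prems(1) unfolding P_def by simp
  \<comment> \<open>The last cut with at most half of the selected indices to its left; unless nothing is left to its right, maximality makes that half full.\<close>
  define p where "p = (GREATEST p. P p)"
  have p: "P p" unfolding p_def
    by (rule GreatestI_nat[where P = P and k = a and b = b]) (rule \<open>P a\<close>, simp add: P_def)
  have pmax: "\<not> P (Suc p)"
    using Greatest_le_nat[of P "Suc p" b] unfolding p_def[symmetric] by (auto simp: P_def)
  have rest: "card (J \<inter> {p<..}) \<le> 2 ^ k"
  proof (cases "p = b")
    case True
    then have "J \<inter> {p<..} = {}" using Suc.prems(3) by auto
    then show ?thesis by simp
  next
    case False
    with p pmax have "card (J \<inter> {..Suc p}) > 2 ^ k" by (auto simp: P_def)
    moreover have "card (J \<inter> {..Suc p}) \<le> Suc (card (J \<inter> {..p}))"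
      by (rule order_trans[OF card_mono[of "insert (Suc p) (J \<inter> {..p})"]])
        (auto simp: fin card_insert_if le_Suc_eq)
    ultimately have "card (J \<inter> {..p}) \<ge> 2 ^ k" by simp
    moreover have "card J = card (J \<inter> {..p}) + card (J \<inter> {p<..})"
      using fin by (subst card_Un_disjoint[symmetric]) (auto intro: arg_cong[of _ _ card])
    ultimately show ?thesis using Suc.prems(4) by simp
  qed
  have ab: "a \<le> p" "p \<le> b" using p by (auto simp: P_def)
  have "(\<Sum>j\<in>J. norm (F j - F (j - 1)))
      = (\<Sum>j\<in>J \<inter> {..p}. norm (F j - F (j - 1))) + (\<Sum>j\<in>J \<inter> {p<..}. norm (F j - F (j - 1)))"
    using fin by (subst sum.union_disjoint[symmetric]) (auto intro: sum.cong)
  also have "\<dots> \<le> (norm (F p - F a) + (real k + 2) * (m p - m a)) + (norm (F b - F p) + (real k + 2) * (m b - m p))"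
    using Suc.prems p rest by (intro add_mono Suc.IH) (auto simp: P_def)
  also have "\<dots> \<le> norm (F b - F a) + (m b - m a) + (real k + 2) * (m b - m a)"
    using kink[OF ab Suc.prems(2)] by (simp add: algebra_simps)
  finally show ?case by (simp add: algebra_simps)
qed

lemma log_gauge_le:
  assumes "0 < d" "d \<le> exp (- L)" "1 \<le> L" "0 < q"
  shows "log_gauge q d \<le> d * L powr (- q)"
proof -
  have "exp L \<le> 1 / d" using assms by (simp add: exp_minus field_simps)
  then have "exp L \<le> exp 1 + 1 / d" by (smt (verit) exp_gt_zero)
  then have "L \<le> ln (exp 1 + 1 / d)"
    using assms by (metis ln_exp ln_le_cancel_iff exp_gt_zero less_le_trans)
  then have "L powr q \<le> ln (exp 1 + 1 / d) powr q" using assms by (intro powr_mono2) auto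
  moreover have "0 < L powr q" using assms by simp
  ultimately have "d / ln (exp 1 + 1 / d) powr q \<le> d / L powr q" using assms by (intro divide_left_mono mult_pos_pos) auto
  then show ?thesis using assms by (simp add: log_gauge_def powr_minus divide_inverse)
qed

lemma log_gauge_le_self: "0 \<le> d \<Longrightarrow> 0 < q \<Longrightarrow> log_gauge q d \<le> d"
proof -
  assume "0 \<le> d" "0 < q"
  have "1 \<le> ln (exp 1 + 1 / d)" if "0 < d"
    using that by (subst ln_ge_iff) (auto intro: add_pos_nonneg)
  then have "1 \<le> ln (exp 1 + 1 / d) powr q" if "0 < d"
    using that \<open>0 < q\<close> by (intro ge_one_powr_ge_zero) auto
  then show ?thesis using \<open>0 \<le> d\<close>
    by (auto simp: log_gauge_def divide_le_eq mult_left_mono intro: order_trans[of _ "d * 1"])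
qed

text \<open>Many terms above \<open>exp (- L)\<close> would have a sum that is large compared with the logarithm of their
  number. So the number of terms is at most exponential in \<open>L\<close>, and its logarithm is at most linear.\<close>
lemma sum_le_of_exp_lower_bound:
  fixes K :: real
  assumes K: "1 \<le> K" and L: "0 \<le> L" and J: "finite J" "\<And>j. j \<in> J \<Longrightarrow> exp (- L) < d j"
    and sub: "\<And>k. card J \<le> 2 ^ k \<Longrightarrow> (\<Sum>j\<in>J. d j) \<le> K * (real k + 1)"
  shows "(\<Sum>j\<in>J. d j) \<le> K * (5 + 4 * ln (8 * K)) * (L + 1)"
proof -
  define k where "k = (LEAST k. card J \<le> 2 ^ k)"
  have ex: "card J \<le> 2 ^ card J" by (simp add: less_imp_le less_exp)
  have k: "card J \<le> 2 ^ k" unfolding k_def by (rule LeastI[of _ "card J"]) (rule ex)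
  have lnK: "0 \<le> ln (8 * K)" using K by (simp add: ln_ge_zero)
  have "real k \<le> 4 * (L + ln (8 * K))"
  proof (cases k)
    case 0
    then show ?thesis using L lnK by simp
  next
    case (Suc k')
    then have "\<not> card J \<le> 2 ^ k'" using not_less_Least[of k' "\<lambda>k. card J \<le> 2 ^ k"] by (simp add: k_def)
    then have "2 ^ k' \<le> real (card J)" by (metis linear of_nat_le_iff of_nat_numeral of_nat_power)
    then have "2 ^ k' * exp (- L) \<le> (\<Sum>j\<in>J. exp (- L))" by simp
    also have "\<dots> \<le> (\<Sum>j\<in>J. d j)" using J(2) by (intro sum_mono) (auto intro: less_imp_le)
    also have "\<dots> \<le> K * (real k + 1)" by (rule sub[OF k])
    finally have 1: "2 ^ k' \<le> K * exp L * (real k + 1)" by (simp add: exp_minus field_simps)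
    \<comment> \<open>The square root of the number of terms, up to a constant: it dominates the logarithm of that number.\<close>
    define s where "s = exp (real k * (ln 2 / 2))"
    have s2: "s * s = 2 * 2 ^ k'"
    proof -
      have "s * s = exp (real k * ln 2)" by (simp add: s_def flip: exp_add)
      also have "\<dots> = 2 ^ k" by (simp add: exp_of_nat_mult)
      finally show ?thesis using Suc by simp
    qed
    have l2: "1/2 \<le> ln (2::real)" "ln (2::real) \<le> 1" using ln_2_less_1 ln2_ge_two_thirds by auto
    have "1 + real k * (ln 2 / 2) \<le> s" unfolding s_def by (rule exp_ge_add_one_self)
    moreover have "real k * (1 / 4) \<le> real k * (ln 2 / 2)" using l2 by (intro mult_left_mono) auto
    ultimately have "real k + 1 \<le> 4 * s" by simp
    then have "K * exp L * (real k + 1) \<le> K * exp L * (4 * s)" using K by (intro mult_left_mono) auto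
    with 1 have "2 ^ k' \<le> K * exp L * (4 * s)" by (rule order_trans)
    then have "s * s \<le> 8 * (K * exp L) * s" unfolding s2 by (simp add: mult_ac)
    then have "s \<le> 8 * (K * exp L)" using s_def by simp
    moreover have "0 < s" by (simp add: s_def)
    ultimately have "ln s \<le> ln (8 * K * exp L)" using K by (simp add: mult.assoc)
    also have "\<dots> = ln (8 * K) + L" using K by (simp add: ln_mult)
    finally have "real k * (ln 2 / 2) \<le> ln (8 * K) + L" by (simp add: s_def)
    with \<open>real k * (1 / 4) \<le> real k * (ln 2 / 2)\<close> show ?thesis by simp
  qed
  then have "real k + 1 \<le> 4 * (L + ln (8 * K)) + 1" by simp
  also have "\<dots> \<le> (5 + 4 * ln (8 * K)) * (L + 1)" using L lnK by (simp add: algebra_simps)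
  finally have "K * (real k + 1) \<le> K * ((5 + 4 * ln (8 * K)) * (L + 1))" using K by (intro mult_left_mono) auto
  with sub[OF k] show ?thesis by (simp add: mult.assoc)
qed

text \<open>The terms between \<open>exp (- 2\<^sup>I\<^sup>+\<^sup>1)\<close> and \<open>exp (- 2\<^sup>I)\<close> have a sum of order \<open>2\<^sup>I\<close>, and on them the gauge gains the
  factor \<open>2\<^sup>-\<^sup>I\<^sup>q\<close>. Because the exponents double from one level to the next, the levels contribute a
  geometric series with ratio \<open>2\<^sup>1\<^sup>-\<^sup>q\<close>; single exponential levels would not be summable by this argument for all
  \<open>q > 1\<close>.\<close>
lemma sum_log_gauge_le:
  fixes K q :: real and d :: "'a \<Rightarrow> real"
  defines "M \<equiv> K * (5 + 4 * ln (8 * K))"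
  assumes K: "1 \<le> K" and q: "1 < q" and J: "finite J" and d0: "\<And>j. j \<in> J \<Longrightarrow> 0 \<le> d j"
    and sub: "\<And>J' k. J' \<subseteq> J \<Longrightarrow> card J' \<le> 2 ^ k \<Longrightarrow> (\<Sum>j\<in>J'. d j) \<le> K * (real k + 1)"
  shows "(\<Sum>j\<in>J. log_gauge q (d j)) \<le> 2 * M + 3 * M / (1 - 2 powr (1 - q))"
proof -
  define \<rho> where "\<rho> = (2::real) powr (1 - q)"
  have rho: "0 < \<rho>" "\<rho> < 1" using q by (auto simp: \<rho>_def powr_less_one)
  have M0: "0 \<le> M" using K by (auto simp: M_def intro!: mult_nonneg_nonneg add_nonneg_nonneg ln_ge_zero)
  have lev: "(\<Sum>j\<in>J'. d j) \<le> M * (L + 1)" if "J' \<subseteq> J" "\<And>j. j \<in> J' \<Longrightarrow> exp (- L) < d j" "0 \<le> L" for J' L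
    unfolding M_def using that sub[OF order_trans] J K
    by (intro sum_le_of_exp_lower_bound) (auto intro: finite_subset)
  have part: "(\<Sum>j | j \<in> J \<and> exp (- (2 ^ I)) < d j. log_gauge q (d j)) \<le> 2 * M + 3 * M * (\<Sum>i<I. \<rho> ^ i)" for I
  proof (induction I)
    case 0
    have "(\<Sum>j | j \<in> J \<and> exp (- 1) < d j. log_gauge q (d j)) \<le> (\<Sum>j | j \<in> J \<and> exp (- 1) < d j. d j)"
      using d0 q by (intro sum_mono log_gauge_le_self) auto
    also have "\<dots> \<le> M * (1 + 1)" by (rule lev) auto
    finally show ?case by simp
  next
    case (Suc I)
    define S where "S = {j. j \<in> J \<and> exp (- (2 ^ Suc I)) < d j \<and> d j \<le> exp (- (2 ^ I))}"
    have "(\<Sum>j\<in>S. log_gauge q (d j)) \<le> (\<Sum>j\<in>S. d j * (2 ^ I) powr (- q))"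
    proof (rule sum_mono)
      fix j assume "j \<in> S"
      then have "exp (- (2 ^ Suc I)) < d j" "d j \<le> exp (- (2 ^ I))" by (auto simp: S_def)
      moreover from this(1) have "0 < d j" using exp_gt_zero less_trans by blast
      ultimately show "log_gauge q (d j) \<le> d j * (2 ^ I) powr (- q)"
        using q by (intro log_gauge_le) auto
    qed
    also have "\<dots> = (\<Sum>j\<in>S. d j) * (2 ^ I) powr (- q)" by (simp add: sum_distrib_right)
    also have "\<dots> \<le> (M * (2 ^ Suc I + 1)) * (2 ^ I) powr (- q)"
      by (intro mult_right_mono lev) (auto simp: S_def)
    also have "\<dots> \<le> (M * (3 * 2 ^ I)) * (2 ^ I) powr (- q)"
      using M0 by (intro mult_right_mono mult_left_mono) auto
    also have "\<dots> = 3 * M * \<rho> ^ I"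
    proof -
      have "(2::real) ^ I * (2 ^ I) powr (- q) = (2 ^ I) powr (1 - q)"
        by (simp add: powr_diff powr_minus field_simps)
      also have "\<dots> = \<rho> ^ I" by (simp add: \<rho>_def powr_powr mult.commute flip: powr_realpow)
      finally show ?thesis by (simp add: mult.assoc)
    qed
    finally have S: "(\<Sum>j\<in>S. log_gauge q (d j)) \<le> 3 * M * \<rho> ^ I" .
    have "exp (- (2 ^ Suc I)) \<le> exp (- (2 ^ I) :: real)" by simp
    note le_less_trans[OF this]
    then have "{j. j \<in> J \<and> exp (- (2 ^ Suc I)) < d j} = {j. j \<in> J \<and> exp (- (2 ^ I)) < d j} \<union> S"
      unfolding S_def by (auto simp del: power_Suc)
    then have "(\<Sum>j | j \<in> J \<and> exp (- (2 ^ Suc I)) < d j. log_gauge q (d j))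
       = (\<Sum>j | j \<in> J \<and> exp (- (2 ^ I)) < d j. log_gauge q (d j)) + (\<Sum>j\<in>S. log_gauge q (d j))"
      using J by (simp only:) (rule sum.union_disjoint, auto simp: S_def)
    then show ?case using Suc S by (simp add: distrib_left)
  qed
  \<comment> \<open>A level below all positive terms; the zero terms do not contribute.\<close>
  define I where "I = (\<Sum>j\<in>J. Suc (nat \<lceil>- ln (d j)\<rceil>))"
  have "exp (- (2 ^ I)) < d j" if "j \<in> J" "0 < d j" for j
  proof -
    have "Suc (nat \<lceil>- ln (d j)\<rceil>) \<le> I"
      unfolding I_def using that J by (intro member_le_sum) auto
    then have "- ln (d j) < real I" by linarith
    also have "\<dots> < 2 ^ I" by (rule of_nat_less_two_power)
    finally have "exp (- (2 ^ I)) < exp (ln (d j))" by simp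
    then show ?thesis using that by simp
  qed
  then have "(\<Sum>j\<in>J. log_gauge q (d j)) = (\<Sum>j | j \<in> J \<and> exp (- (2 ^ I)) < d j. log_gauge q (d j))"
    using J d0 by (intro sum.mono_neutral_right) (auto simp: log_gauge_def)
  also have "\<dots> \<le> 2 * M + 3 * M * (\<Sum>i<I. \<rho> ^ i)" by (rule part)
  also have "(\<Sum>i<I. \<rho> ^ i) \<le> 1 / (1 - \<rho>)"
    using rho by (simp add: sum_gp_strict divide_right_mono)
  finally show ?thesis using M0 by (simp add: \<rho>_def mult_left_mono)
qed

text \<open>On a line in the direction \<open>b - a\<close> the kink bound controls the deviation from affine interpolation
  by the increment of the monotone function \<open>c * (p s \<bullet> (b - a))\<close>. The resulting bound depends on a
  partition only through the two end points.\<close>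
lemma finite_log_variation_of_kink_bound:
  fixes f :: "real^4 \<Rightarrow> real^4"
  assumes kink: "\<And>x y l. \<lbrakk>0 \<le> l; l \<le> 1\<rbrakk> \<Longrightarrow>
      norm (f (x + l *\<^sub>R (y - x)) - (1 - l) *\<^sub>R f x - l *\<^sub>R f y) * norm (y - x) \<le> C * ((f y - f x) \<bullet> (y - x))"
    and q: "1 < q" and ab: "a \<noteq> b"
  shows "finite_variation_on_segment (log_gauge q) a b f"
proof -
  define c where "c = 2 * C / norm (b - a)"
  define p where "p s = f (a + s *\<^sub>R (b - a))" for s
  have kink': "norm (p u - p s) + norm (p s' - p u) \<le> norm (p s' - p s) + (c * (p s' \<bullet> (b - a)) - c * (p s \<bullet> (b - a)))"
    if "s \<le> u" "u \<le> s'" for s u s'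
  proof (cases "s = s'")
    case True
    then show ?thesis using that by simp
  next
    case False
    with that have ss: "s < s'" by simp
    define l where "l = (u - s) / (s' - s)"
    \<comment> \<open>The two halves differ from the proportional parts of the chord by the kink vector.\<close>
    define k where "k = p u - (1 - l) *\<^sub>R p s - l *\<^sub>R p s'"
    have l: "0 \<le> l" "l \<le> 1" using that ss by (auto simp: l_def)
    have "l * (s' - s) = u - s" using ss by (simp add: l_def)
    then have u: "a + s *\<^sub>R (b - a) + l *\<^sub>R ((a + s' *\<^sub>R (b - a)) - (a + s *\<^sub>R (b - a))) = a + u *\<^sub>R (b - a)"
    proof -
      have "a + s *\<^sub>R v + l *\<^sub>R ((a + s' *\<^sub>R v) - (a + s *\<^sub>R v)) = a + (s + l * (s' - s)) *\<^sub>R v" for v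
        by (simp add: algebra_simps)
      from this[of "b - a"] show ?thesis by (simp only: \<open>l * (s' - s) = u - s\<close>) simp
    qed
    have "norm k * ((s' - s) * norm (b - a)) \<le> C * ((p s' - p s) \<bullet> ((s' - s) *\<^sub>R (b - a)))"
      using kink[OF l, of "a + s *\<^sub>R (b - a)" "a + s' *\<^sub>R (b - a)"] ss
      unfolding u by (simp add: k_def p_def flip: scaleR_diff_left)
    then have "(s' - s) * (norm k * norm (b - a)) \<le> (s' - s) * (C * ((p s' - p s) \<bullet> (b - a)))"
      by (simp add: mult_ac)
    then have "norm k * norm (b - a) \<le> C * ((p s' - p s) \<bullet> (b - a))" using ss by simp
    then have "2 * norm k \<le> c * ((p s' - p s) \<bullet> (b - a))"
      using ab by (simp add: c_def field_simps)
    moreover have "norm (p u - p s) \<le> l * norm (p s' - p s) + norm k"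
    proof -
      have "p u - p s = l *\<^sub>R (p s' - p s) + k" by (simp add: k_def algebra_simps)
      then show ?thesis using norm_triangle_ineq[of "l *\<^sub>R (p s' - p s)" k] l by simp
    qed
    moreover have "norm (p s' - p u) \<le> (1 - l) * norm (p s' - p s) + norm k"
    proof -
      have "p s' - p u = (1 - l) *\<^sub>R (p s' - p s) - k" by (simp add: k_def algebra_simps)
      then show ?thesis using norm_triangle_ineq4[of "(1 - l) *\<^sub>R (p s' - p s)" k] l by simp
    qed
    ultimately show ?thesis by (simp add: inner_diff_left right_diff_distrib left_diff_distrib)
  qed
  define K where "K = max 1 (norm (f b - f a) + 2 * (c * (f b \<bullet> (b - a)) - c * (f a \<bullet> (b - a))))"
  define B where "B = 2 * (K * (5 + 4 * ln (8 * K))) + 3 * (K * (5 + 4 * ln (8 * K))) / (1 - 2 powr (1 - q))"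
  have "(\<Sum>j=1..N. log_gauge q (norm (p (t j) - p (t (j - 1))))) \<le> B" if t: "unit_partition N t" for N t
    unfolding B_def
  proof (rule sum_log_gauge_le)
    fix J' k assume J': "J' \<subseteq> {1..N}" "card J' \<le> 2 ^ k"
    have tmono: "t i \<le> t j" if "i \<le> j" "j \<le> N" for i j
      using that(1)
    proof (rule inc_induct)
      show "t n \<le> t j" if "i \<le> n" "n < j" "t (Suc n) \<le> t j" for n
        using t that \<open>j \<le> N\<close> unfolding unit_partition_def by (smt (verit) less_le_trans)
    qed simp
    have ends: "p (t 0) = f a" "p (t N) = f b" using t by (auto simp: unit_partition_def p_def)
    have "(\<Sum>j\<in>J'. norm (p (t j) - p (t (j - 1))))
        \<le> norm (p (t N) - p (t 0)) + (real k + 2) * (c * (p (t N) \<bullet> (b - a)) - c * (p (t 0) \<bullet> (b - a)))"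
    proof (rule sum_increments_le_log_card[where F = "\<lambda>j. p (t j)" and m = "\<lambda>j. c * (p (t j) \<bullet> (b - a))" and N = N])
      show "norm (p (t u) - p (t i)) + norm (p (t j) - p (t u))
        \<le> norm (p (t j) - p (t i)) + (c * (p (t j) \<bullet> (b - a)) - c * (p (t i) \<bullet> (b - a)))"
        if "i \<le> u" "u \<le> j" "j \<le> N" for i u j
        using that by (intro kink' tmono) auto
    qed (use J' in auto)
    also have "\<dots> \<le> K * (real k + 1)"
    proof -
      define D where "D = c * (f b \<bullet> (b - a)) - c * (f a \<bullet> (b - a))"
      have "0 \<le> D" using kink'[of 0 0 1] by (simp add: D_def p_def)
      then have "norm (f b - f a) + (real k + 2) * D \<le> (norm (f b - f a) + 2 * D) * (real k + 1)"
        by (simp add: algebra_simps)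
      also have "\<dots> \<le> K * (real k + 1)" by (intro mult_right_mono) (auto simp: K_def D_def)
      finally show ?thesis unfolding ends D_def .
    qed
    finally show "(\<Sum>j\<in>J'. norm (p (t j) - p (t (j - 1)))) \<le> K * (real k + 1)" .
  qed (use q in \<open>auto simp: K_def\<close>)
  then show ?thesis
    unfolding finite_variation_on_segment_def bdd_above_def p_def by blast
qed

section \<open>Finite variation of reduced quasiconformal mappings\<close>

theorem theorem5p8:
  fixes f :: "real^4 \<Rightarrow> real^4" and q :: real
  assumes "reduced_quasiconformal f" and "q > 1"
  shows "finite_variation_on_lines (log_gauge q) UNIV f"
proof -
  from assms(1) obtain g Df \<delta> where hom: "homeomorphism UNIV UNIV f g"
    and weak: "has_weak_derivative f Df" and d: "0 < \<delta>" "\<delta> \<le> 1"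
    and cone: "AE x in lebesgue. Df x - quat_Im (quat_proj (Df x)) \<in> matrix_cone \<delta>"
    unfolding reduced_quasiconformal_def by blast
  have f: "continuous_on UNIV f" using hom by (simp add: homeomorphism_def)
  define c where "c = \<delta>\<^sup>2 / 96"
  have c: "0 < c" using d by (simp add: c_def)
  have "AE y in lebesgue. \<forall>v. c * trace (Df y) * (norm v)\<^sup>2 \<le> (Df y *v v) \<bullet> v"
    using cone by (rule eventually_mono) (use reduced_cone_quadratic_form_bounds(1)[OF _ d] in \<open>auto simp: c_def\<close>)
  moreover have "AE y in lebesgue. \<forall>v. 0 \<le> (Df y *v v) \<bullet> v"
    using cone by (rule eventually_mono) (use reduced_cone_quadratic_form_bounds(2)[OF _ d] in auto)
  ultimately obtain F A where F: "\<And>n. pinched c (F n) (A n)" "\<And>x. (\<lambda>n. F n x) \<longlonglongrightarrow> f x"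
    using pinched_approximation[OF f weak] by blast
  obtain C where C: "\<And>(h :: real^4 \<Rightarrow> real^4) A x y l. \<lbrakk>pinched c h A; 0 \<le> l; l \<le> 1\<rbrakk> \<Longrightarrow>
      norm (h (x + l *\<^sub>R (y - x)) - (1 - l) *\<^sub>R h x - l *\<^sub>R h y) * norm (y - x) \<le> C * mono_form h y x"
    using pinched_kink_bound[OF c] by blast
  have kink: "norm (f (x + l *\<^sub>R (y - x)) - (1 - l) *\<^sub>R f x - l *\<^sub>R f y) * norm (y - x) \<le> C * ((f y - f x) \<bullet> (y - x))"
    if "0 \<le> l" "l \<le> 1" for x y l
  proof (rule LIMSEQ_le)
    show "(\<lambda>n. norm (F n (x + l *\<^sub>R (y - x)) - (1 - l) *\<^sub>R F n x - l *\<^sub>R F n y) * norm (y - x))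
        \<longlonglongrightarrow> norm (f (x + l *\<^sub>R (y - x)) - (1 - l) *\<^sub>R f x - l *\<^sub>R f y) * norm (y - x)"
      by (intro tendsto_intros F)
    show "(\<lambda>n. C * ((F n y - F n x) \<bullet> (y - x))) \<longlonglongrightarrow> C * ((f y - f x) \<bullet> (y - x))"
      by (intro tendsto_intros F)
    show "\<exists>N. \<forall>n\<ge>N. norm (F n (x + l *\<^sub>R (y - x)) - (1 - l) *\<^sub>R F n x - l *\<^sub>R F n y) * norm (y - x)
        \<le> C * ((F n y - F n x) \<bullet> (y - x))"
      using C[OF F(1) that] by (auto simp: mono_form_def)
  qed
  show ?thesis
    unfolding finite_variation_on_lines_def
    using finite_log_variation_of_kink_bound[OF kink \<open>q > 1\<close>] by blast
qed

end
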